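(* Let $A$ be a balanced matrix with $n$ rows and with distinct nonzero column vectors $v_1,\ldots,v_q$. If there is $d$ such that $|v_i|=d$ for all $i$, then any regular triangulation of the cone $\mathbb{R}_+\{v_1,\ldots,v_q\}$ is unimodular.
   Context: A matrix with entries in $\{0,1\}$ is balanced if it has no square submatrix of odd size with exactly two $1$'s in each row and column (for size at least 3). $|v_i|$ is the sum of the entries of $v_i$; $\mathbb{R}_+\mathcal{A}$ is the cone of non-negative real combinations of $\mathcal{A}$. Regular triangulations: let $\mathcal{A}=\{v_1,\ldots,v_q\}$, $K$ a field, $F=\{x^{v_1},\ldots,x^{v_q}\}$, and let $P$ be the toric ideal of $K[F]$, i.e. the kernel of the $K$-algebra homomorphism $K[t_1,\ldots,t_q]\to K[x_1,\ldots,x_n]$, $t_i\mapsto x^{v_i}$. For a term order $\prec$ on $K[t_1,\ldots,t_q]$, write $\mathrm{rad}(\mathrm{in}_\prec(P))=\mathfrak{p}_1\cap\cdots\cap\mathfrak{p}_m$ as the irredundant intersection of primes generated by subsets of $\{t_1,\ldots,t_q\}$, and put $\mathcal{A}_i=\{v_j\mid t_j\notin\mathfrak{p}_i\}$. The family $\{\mathcal{A}_1,\ldots,\mathcal{A}_m\}$ (equivalently, the family of cones $\{\mathbb{R}_+\mathcal{A}_1,\ldots,\mathbb{R}_+\mathcal{A}_m\}$) is a regular triangulation of $\mathcal{A}$ (of $\mathbb{R}_+\mathcal{A}$), and regular triangulations are those arising in this way. Equivalently, if $\omega\in\mathbb{N}^q$ is a weight vector with $\mathrm{in}_\prec(P)=\mathrm{in}_\omega(P)$,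 then the $\mathcal{A}_i$ are the facets of the simplicial complex of all $\{v_i\}_{i\in\sigma}$ for which there is $c\in\mathbb{R}^n$ with $\langle v_i,c\rangle=\omega_i$ if $i\in\sigma$ and $\langle v_i,c\rangle<\omega_i$ if $i\notin\sigma$. The triangulation is unimodular if $\mathbb{Z}\mathcal{A}_i=\mathbb{Z}\mathcal{A}$ for all $i$, where $\mathbb{Z}\mathcal{A}$ is the subgroup of $\mathbb{Z}^n$ generated by $\mathcal{A}$. *)

theory Defs
  imports "HOL-Analysis.Analysis" "HOL-Library.Poly_Mapping"
begin

section \<open>Balanced matrices\<close>

text \<open>
  A square submatrix is given by its set \<open>R\<close> of rows and its set \<open>C\<close> of columns; the order of the
  rows and columns is irrelevant for the number of ones in them.
\<close>

definition balanced_matrix :: "nat ^ 'q ^ 'n \<Rightarrow> bool" where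
  "balanced_matrix A \<longleftrightarrow>
     (\<forall>i j. A $ i $ j \<in> {0, 1}) \<and>
     \<not> (\<exists>R C. card R = card C \<and> odd (card R) \<and> card R \<ge> 3 \<and>
            (\<forall>i\<in>R. card {j\<in>C. A $ i $ j = 1} = 2) \<and>
            (\<forall>j\<in>C. card {i\<in>R. A $ i $ j = 1} = 2))"


section \<open>Polynomials, ideals and initial ideals\<close>

text \<open>
  Monomials are identified with their exponent vectors; polynomials are finitely supported functions
  on monomials, with the convolution product.
\<close>

type_synonym 'i monomial = "'i \<Rightarrow>\<^sub>0 nat"
type_synonym ('i, 'k) polynomial = "'i monomial \<Rightarrow>\<^sub>0 'k"

definition pconst :: "'k::zero \<Rightarrow> ('i, 'k) polynomial" where
  "pconst c = Poly_Mapping.single 0 c"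

definition pmonom :: "'i monomial \<Rightarrow> ('i, 'k::zero_neq_one) polynomial" where
  "pmonom m = Poly_Mapping.single m 1"

definition pvar :: "'i \<Rightarrow> ('i, 'k::zero_neq_one) polynomial" where
  "pvar i = pmonom (Poly_Mapping.single i 1)"

text \<open>An ideal is a submodule of the ring regarded as a module over itself.\<close>

lemma module_times: "module ((*) :: 'r::comm_ring_1 \<Rightarrow> 'r \<Rightarrow> 'r)"
  by unfold_locales (simp_all add: algebra_simps)

abbreviation is_ideal :: "'r::comm_ring_1 set \<Rightarrow> bool" where
  "is_ideal \<equiv> module.subspace (*)"

abbreviation ideal_gen :: "'r::comm_ring_1 set \<Rightarrow> 'r set" where
  "ideal_gen \<equiv> module.span (*)"

definition prime_ideal :: "'r::comm_ring_1 set \<Rightarrow> bool" where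
  "prime_ideal I \<longleftrightarrow> is_ideal I \<and> I \<noteq> UNIV \<and> (\<forall>a b. a * b \<in> I \<longrightarrow> a \<in> I \<or> b \<in> I)"

definition radical :: "'r::comm_ring_1 set \<Rightarrow> 'r set" where
  "radical I = {f. \<exists>k. f ^ k \<in> I}"

text \<open>\<open>(m, m') \<in> r\<close> is read as \<open>m \<prec> m'\<close>.\<close>

definition term_order :: "('i monomial \<times> 'i monomial) set \<Rightarrow> bool" where
  "term_order r \<longleftrightarrow> strict_linear_order r \<and> (\<forall>m. m \<noteq> 0 \<longrightarrow> (0, m) \<in> r) \<and>
     (\<forall>m m' u. (m, m') \<in> r \<longrightarrow> (m + u, m' + u) \<in> r)"

definition is_initial_monomial ::
    "('i monomial \<times> 'i monomial) set \<Rightarrow> ('i, 'k::zero) polynomial \<Rightarrow> 'i monomial \<Rightarrow> bool" where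
  "is_initial_monomial r f m \<longleftrightarrow>
     m \<in> Poly_Mapping.keys f \<and> (\<forall>m'\<in>Poly_Mapping.keys f. m' \<noteq> m \<longrightarrow> (m', m) \<in> r)"

definition initial_ideal ::
    "('i monomial \<times> 'i monomial) set \<Rightarrow> ('i, 'k::field) polynomial set \<Rightarrow> ('i, 'k) polynomial set" where
  "initial_ideal r I = ideal_gen {pmonom m |m. \<exists>f\<in>I. is_initial_monomial r f m}"


section \<open>Toric ideals\<close>

definition vec_exponent :: "nat ^ 'n \<Rightarrow> 'n monomial" where
  "vec_exponent u = (\<Sum>k\<in>UNIV. Poly_Mapping.single k (u $ k))"

text \<open>The \<open>K\<close>-algebra homomorphism sending the variable \<open>t\<^sub>i\<close> to the monomial with exponent \<open>v i\<close>.\<close>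

definition toric_map ::
    "('q::finite \<Rightarrow> nat ^ 'n) \<Rightarrow> ('q, 'k::field) polynomial \<Rightarrow> ('n, 'k) polynomial" where
  "toric_map v f = (\<Sum>m\<in>Poly_Mapping.keys f. pconst (Poly_Mapping.lookup f m) *
     (\<Prod>i\<in>UNIV. pmonom (vec_exponent (v i)) ^ Poly_Mapping.lookup m i))"

definition toric_ideal :: "('q::finite \<Rightarrow> nat ^ 'n) \<Rightarrow> ('q, 'k::field) polynomial set" where
  "toric_ideal v = {f. toric_map v f = 0}"

lemma lookup_vec_exponent: "Poly_Mapping.lookup (vec_exponent u) k = u $ k"
  by (simp add: vec_exponent_def lookup_sum lookup_single when_def)

lemma toric_map_pconst: "toric_map v (pconst c) = pconst c"
  by (simp add: toric_map_def pconst_def)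

lemma toric_map_pvar:
  fixes v :: "'q::finite \<Rightarrow> nat ^ 'n"
  shows "toric_map v (pvar i :: ('q::finite, 'k::field) polynomial) = pmonom (vec_exponent (v i))"
proof -
  have "(\<Prod>j\<in>UNIV. (pmonom (vec_exponent (v j)) :: ('n, 'k) polynomial) ^
           Poly_Mapping.lookup (Poly_Mapping.single i (1::nat)) j)
        = (\<Prod>j\<in>UNIV. if j = i then pmonom (vec_exponent (v j)) else 1)"
    by (rule prod.cong) (auto simp: lookup_single when_def)
  then show ?thesis
    by (simp add: toric_map_def pvar_def pmonom_def pconst_def)
qed

lemma toric_map_superset:
  assumes "finite S" "Poly_Mapping.keys f \<subseteq> S"
  shows "toric_map v f = (\<Sum>m\<in>S. pconst (Poly_Mapping.lookup f m) *
     (\<Prod>i\<in>UNIV. pmonom (vec_exponent (v i)) ^ Poly_Mapping.lookup m i))"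
  unfolding toric_map_def
  by (rule sum.mono_neutral_left) (use assms in \<open>auto simp: pconst_def in_keys_iff\<close>)

lemma toric_map_add: "toric_map v (f + g) = toric_map v f + toric_map v g"
proof -
  let ?S = "Poly_Mapping.keys f \<union> Poly_Mapping.keys g"
  have "Poly_Mapping.keys (f + g) \<subseteq> ?S" by (rule Poly_Mapping.keys_add)
  then show ?thesis
    by (simp add: toric_map_superset[where S = ?S] lookup_add pconst_def single_add
        distrib_right sum.distrib)
qed

lemma toric_map_single: "toric_map v (Poly_Mapping.single m c) = pconst c *
     (\<Prod>i\<in>UNIV. pmonom (vec_exponent (v i)) ^ Poly_Mapping.lookup m i)"
  by (simp add: toric_map_def pconst_def)

lemma polynomial_induct [case_names single add]:
  assumes "\<And>m c. P (Poly_Mapping.single m c)"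
    and "\<And>f g. P f \<Longrightarrow> P g \<Longrightarrow> P (f + g)"
  shows "P (f :: ('i, 'k::comm_monoid_add) polynomial)"
proof (induction f rule: Poly_Mapping.update_induct)
  case const
  show ?case using assms(1)[of 0 0] by simp
next
  case (update f a b)
  have "Poly_Mapping.update a b f = f + Poly_Mapping.single a b"
    using update(1)
    by (intro poly_mapping_eqI) (auto simp: lookup_update lookup_add lookup_single when_def in_keys_iff)
  then show ?case using assms update by simp
qed

lemma pconst_mult: "pconst (c * c') = pconst c * pconst (c' :: 'k::semiring_0)"
  by (simp add: pconst_def mult_single)

lemma toric_map_mult: "toric_map v (f * g) = toric_map v f * toric_map v g"
proof (induction f rule: polynomial_induct)
  case (single m c)
  show ?case
  proof (induction g rule: polynomial_induct)
    case (single m' c')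
    show ?case
      by (simp add: pconst_mult mult_single toric_map_single lookup_add power_add prod.distrib mult_ac)
  next
    case (add g g')
    then show ?case by (simp add: toric_map_add distrib_left)
  qed
next
  case (add f f')
  then show ?case by (simp add: toric_map_add distrib_right)
qed


section \<open>Regular and unimodular triangulations\<close>

text \<open>
  The triangulation of \<open>{v i | i}\<close> determined by a term order \<open>r\<close>: \<open>\<P>\<close> is the set of primes in the
  irredundant decomposition of the radical of the initial ideal of the toric ideal. The triangulation
  is represented by its family of generating sets rather than by the cones spanned by these.
  The type argument is the coefficient field.
\<close>

definition regular_triangulation ::
    "'k::field itself \<Rightarrow> ('q::finite \<Rightarrow> nat ^ 'n) \<Rightarrow> (nat ^ 'n) set set \<Rightarrow> bool" where
  "regular_triangulation K v \<T> \<longleftrightarrow>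
     (\<exists>r (\<P> :: ('q, 'k) polynomial set set).
        term_order r \<and>
        finite \<P> \<and>
        (\<forall>p\<in>\<P>. prime_ideal p \<and> (\<exists>S. p = ideal_gen (pvar ` S))) \<and>
        \<Inter>\<P> = radical (initial_ideal r (toric_ideal v)) \<and>
        (\<forall>p\<in>\<P>. \<Inter>(\<P> - {p}) \<noteq> radical (initial_ideal r (toric_ideal v))) \<and>
        \<T> = (\<lambda>p. {v j |j. pvar j \<notin> p}) ` \<P>)"

text \<open>The subgroup of \<open>\<int>\<^sup>n\<close> generated by a set of vectors is its span over \<open>\<int>\<close>.\<close>

lemma module_int_vec: "module ((*s) :: int \<Rightarrow> int ^ 'n \<Rightarrow> int ^ 'n)"
  by unfold_locales
    (simp_all add: vector_add_ldistrib vector_sadd_rdistrib vector_smult_assoc)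

definition lattice_gen :: "(nat ^ 'n) set \<Rightarrow> (int ^ 'n) set" where
  "lattice_gen B = module.span (*s) ((\<lambda>u. \<chi> k. int (u $ k)) ` B)"

definition unimodular :: "(nat ^ 'n) set \<Rightarrow> (nat ^ 'n) set set \<Rightarrow> bool" where
  "unimodular \<A> \<T> \<longleftrightarrow> (\<forall>B\<in>\<T>. lattice_gen B = lattice_gen \<A>)"

end

theory Submission
  imports Defs
begin

text \<open>
  Let \<open>J\<close> index the generators of one cone of the triangulation. Minimality of the corresponding prime
  forces the columns in \<open>J\<close> to span all columns over the reals, so it remains to see that an integral
  vector \<open>a\<close> in their real span lies in the group they generate; adding a multiple of their sum, we
  may assume that \<open>a\<close> is a nonnegative combination with coefficient sum \<open>\<sigma>\<close>. Balancedness enters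
  through Berge's theorem on good colourings, which makes the covering polyhedron
  \<open>{x \<ge> 0. x A \<ge> 1}\<close> integral. By duality the packing problem \<open>A z \<le> a\<close> then has a solution over the
  natural numbers with coefficient sum at least \<open>\<sigma>\<close>, and since all columns have the same sum \<open>d > 0\<close>,
  comparing entry sums turns \<open>A z \<le> a\<close> into an equality.
\<close>


section \<open>Good colourings of balanced hypergraphs\<close>

text \<open>
  The incidence condition already forces the vertices and the edges of an odd cycle to be distinct.
  In particular replicating vertices creates no new odd cycles.
\<close>

definition odd_cycle :: "('v \<Rightarrow> 'e \<Rightarrow> bool) \<Rightarrow> nat \<Rightarrow> (nat \<Rightarrow> 'v) \<Rightarrow> (nat \<Rightarrow> 'e) \<Rightarrow> bool" where
  "odd_cycle inc k x E \<longleftrightarrow> odd k \<and> k \<ge> 3 \<and>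
     (\<forall>i<k. \<forall>j<k. inc (x i) (E j) \<longleftrightarrow> i = j \<or> i = Suc j mod k)"

text \<open>A hyperedge with three or more vertices in \<open>V\<close> keeps two of them when a
  vertex is deleted. In an induction on \<open>V\<close> only the hyperedges meeting
  \<open>V\<close> in exactly two vertices constrain the deleted vertex; these are read as the edges
  of a graph.\<close>

definition two_edges :: "('v \<Rightarrow> 'e \<Rightarrow> bool) \<Rightarrow> 'v set \<Rightarrow> ('v \<times> 'v) set" where
  "two_edges inc V = {(u, w). u \<noteq> w \<and> (\<exists>e. {v\<in>V. inc v e} = {u, w})}"

lemma sym_two_edges: "(u, w) \<in> two_edges inc V \<Longrightarrow> (w, u) \<in> two_edges inc V"
  unfolding two_edges_def by (auto simp: insert_commute)

lemma relpow_segment: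
  assumes "\<And>i. i < n \<Longrightarrow> (f i, f (Suc i)) \<in> R" "i \<le> j" "j \<le> n"
  shows "(f i, f j) \<in> R ^^ (j - i)"
  unfolding relpow_fun_conv
  by (rule exI[of _ "\<lambda>m. f (i + m)"]) (use assms in auto)

lemma relpow_sym:
  assumes "(a, b) \<in> R ^^ n" "\<And>x y. (x, y) \<in> R \<Longrightarrow> (y, x) \<in> R"
  shows "(b, a) \<in> R ^^ n"
  using assms(1)
proof (induction n arbitrary: b)
  case (Suc n)
  then obtain c where "(a, c) \<in> R ^^ n" "(c, b) \<in> R" by auto
  with Suc.IH assms(2) show ?case by (meson relpow_Suc_I2)
qed auto

text \<open>A shortest odd closed walk repeats no vertex, since a repetition cuts it into two
  shorter closed walks, one of them odd. Each hyperedge it uses meets \<open>V\<close> only in the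
  two ends of its step, so the walk is an odd cycle of the hypergraph.\<close>

lemma closed_walk_even:
  assumes "\<And>k x E. \<not> odd_cycle inc k x E" "(a, a) \<in> two_edges inc V ^^ k"
  shows "even k"
  using assms(2)
proof (induction k arbitrary: a rule: less_induct)
  case (less k)
  let ?G = "two_edges inc V"
  show ?case
  proof (rule ccontr)
    assume odd: "odd k"
    obtain f where f: "f 0 = a" "f k = a" "\<And>i. i < k \<Longrightarrow> (f i, f (Suc i)) \<in> ?G"
      using less.prems unfolding relpow_fun_conv by auto
    have inj: "i = j" if "i < k" "j < k" "f i = f j" for i j
    proof -
      have False if ij: "i < j" "j < k" "f i = f j" for i j
      proof -
        have e: "even (j - i)"
          using less.IH[of "j - i" "f i"] relpow_segment[of k f ?G i j] f(3) ij by auto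
        have "(f 0, f i) \<in> ?G ^^ i" "(f j, f k) \<in> ?G ^^ (k - j)"
          using relpow_segment[of k f ?G 0 i] relpow_segment[of k f ?G j k] f(3) ij by auto
        then have "(a, a) \<in> ?G ^^ (i + (k - j))"
          using f ij(3) by (auto simp: relpow_add)
        moreover have "i + (k - j) < k" using ij by auto
        ultimately have "even (i + (k - j))" by (intro less.IH)
        moreover have "k = (j - i) + (i + (k - j))" using ij by auto
        ultimately show False using odd e by (metis even_add)
      qed
      then show ?thesis using that by (metis nat_neq_iff)
    qed
    have "k \<noteq> 1" using f(3)[of 0] f(1,2) by (auto simp: two_edges_def)
    with odd have k3: "k \<ge> 3" by presburger
    have "\<exists>E. \<forall>j<k. {v\<in>V. inc v (E j)} = {f j, f (Suc j)}"
      using f(3) unfolding two_edges_def by (intro choice) auto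
    then obtain E where E: "\<And>j. j < k \<Longrightarrow> {v\<in>V. inc v (E j)} = {f j, f (Suc j)}" by auto
    have "odd_cycle inc k f E"
      unfolding odd_cycle_def
    proof (intro conjI allI impI)
      fix i j assume ij: "i < k" "j < k"
      have "f i \<in> V" using E[of i] ij by auto
      then have "inc (f i) (E j) \<longleftrightarrow> f i = f j \<or> f i = f (Suc j)" using E[of j] ij by blast
      also have "f (Suc j) = f (Suc j mod k)"
        using ij f(1,2) by (cases "Suc j = k") auto
      finally show "inc (f i) (E j) \<longleftrightarrow> i = j \<or> i = Suc j mod k"
        using inj ij k3 by (metis mod_less_divisor less_nat_zero_code not_gr_zero)
    qed (use odd k3 in auto)
    with assms(1) show False by blast
  qed
qed

text \<open>
  Remove a vertex \<open>v\<close> at maximal distance from a root in the graph of two-element edges and colour the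
  rest. The neighbours of \<open>v\<close> are joined to the root by walks avoiding \<open>v\<close>, and as there are no odd
  closed walks these have equal parity; so the neighbours share a colour and \<open>v\<close> gets the other one.
\<close>

lemma two_colouring:
  assumes "\<And>k x E. \<not> odd_cycle inc k x E" "finite V"
  shows "\<exists>f :: 'v \<Rightarrow> bool. \<forall>e. card {v\<in>V. inc v e} \<ge> 2 \<longrightarrow>
           (\<exists>u\<in>V. inc u e \<and> f u) \<and> (\<exists>w\<in>V. inc w e \<and> \<not> f w)"
  using assms(2)
proof (induction V rule: finite_psubset_induct)
  case (psubset V)
  show ?case
  proof (cases "V = {}")
    case True
    then show ?thesis by auto
  next
    case False
    then obtain r where r: "r \<in> V" by auto
    let ?G = "two_edges inc V"
    define W where "W = {u. \<exists>n. (r, u) \<in> ?G ^^ n}"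
    have "r \<in> W" unfolding W_def by (auto intro: exI[of _ 0])
    have G_V: "u \<in> V" "w \<in> V" if "(u, w) \<in> ?G" for u w
      using that unfolding two_edges_def by auto
    have W_closed: "w \<in> W" if "u \<in> W" "(u, w) \<in> ?G" for u w
    proof -
      obtain n where "(r, u) \<in> ?G ^^ n" using \<open>u \<in> W\<close> by (auto simp: W_def)
      then have "(r, w) \<in> ?G ^^ Suc n" using \<open>(u, w) \<in> ?G\<close> by (rule relpow_Suc_I)
      then show ?thesis unfolding W_def by blast
    qed
    have "W \<subseteq> V"
    proof
      fix u assume "u \<in> W"
      then obtain n where "(r, u) \<in> ?G ^^ n" by (auto simp: W_def)
      then show "u \<in> V" by (cases n) (use r G_V in auto)
    qed
    then have "finite W" using psubset.hyps finite_subset by auto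
    define dist where "dist u = (LEAST n. (r, u) \<in> ?G ^^ n)" for u
    have dist: "(r, u) \<in> ?G ^^ dist u" if "u \<in> W" for u
      using that unfolding W_def dist_def by (auto intro: LeastI)
    have dist_le: "dist u \<le> n" if "(r, u) \<in> ?G ^^ n" for u n
      using that unfolding dist_def by (rule Least_le)
    obtain v where v: "v \<in> W" "\<And>u. u \<in> W \<Longrightarrow> dist u \<le> dist v"
    proof -
      have "Max (dist ` W) \<in> dist ` W" using \<open>finite W\<close> \<open>r \<in> W\<close> by (intro Max_in) auto
      then obtain v where "v \<in> W" "dist v = Max (dist ` W)" by auto
      then show thesis using that \<open>finite W\<close> by (metis Max_ge finite_imageI imageI)
    qed
    have "V - {v} \<subset> V" using v(1) \<open>W \<subseteq> V\<close> by auto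
    from psubset.IH[OF this] obtain f :: "'v \<Rightarrow> bool" where
      f: "\<And>e. card {w\<in>V - {v}. inc w e} \<ge> 2 \<Longrightarrow>
           (\<exists>u\<in>V - {v}. inc u e \<and> f u) \<and> (\<exists>w\<in>V - {v}. inc w e \<and> \<not> f w)"
      by blast
    \<comment> \<open>A graph edge avoiding \<open>v\<close> still has two vertices in
      \<open>V - {v}\<close>, so the induction hypothesis gives its ends different colours.\<close>
    have alt: "f u \<longleftrightarrow> \<not> f w" if uw: "(u, w) \<in> ?G" "u \<noteq> v" "w \<noteq> v" for u w
    proof -
      obtain e where e: "{x\<in>V. inc x e} = {u, w}" and "u \<noteq> w"
        using uw(1) unfolding two_edges_def by blast
      then have "{x\<in>V - {v}. inc x e} = {u, w}" using uw by auto
      then have in_e: "x \<in> V - {v} \<and> inc x e \<longleftrightarrow> x = u \<or> x = w" for x by blast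
      have "card {x\<in>V - {v}. inc x e} \<ge> 2"
        unfolding \<open>{x\<in>V - {v}. inc x e} = {u, w}\<close> using \<open>u \<noteq> w\<close> by simp
      from f[OF this] in_e show ?thesis by metis
    qed
    have parity: "f u \<longleftrightarrow> (f r \<longleftrightarrow> even (dist u))" if "u \<in> W" "u \<noteq> v" for u
      using that
    proof (induction "dist u" arbitrary: u)
      case 0
      then have "u = r" using dist[of u] by auto
      then show ?case using 0 by simp
    next
      case (Suc n)
      from Suc.hyps(2) dist[OF Suc.prems(1)] obtain w
        where w: "(r, w) \<in> ?G ^^ n" "(w, u) \<in> ?G" by (metis relpow_Suc_E)
      then have "w \<in> W" by (auto simp: W_def)
      have "dist w \<le> n" using dist_le w by auto
      moreover have "dist u \<le> Suc (dist w)"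
        using dist_le relpow_Suc_I[OF dist[OF \<open>w \<in> W\<close>] w(2)] by auto
      ultimately have "dist w = n" using Suc.hyps(2) by auto
      \<comment> \<open>\<open>w\<close> is closer to the root than \<open>u\<close>, while
        \<open>dist v\<close> is maximal; hence a shortest walk to \<open>u\<close> avoids
        \<open>v\<close>.\<close>
      moreover have "w \<noteq> v" using v(2)[OF Suc.prems(1)] \<open>dist w = n\<close> Suc.hyps(2) by auto
      ultimately have "f w \<longleftrightarrow> (f r \<longleftrightarrow> even (dist w))" using Suc.hyps(1) \<open>w \<in> W\<close> by auto
      moreover have "f w \<longleftrightarrow> \<not> f u" using alt w \<open>w \<noteq> v\<close> Suc.prems by auto
      ultimately show ?case using \<open>dist w = n\<close> Suc.hyps(2)[symmetric] by auto
    qed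
    have same: "f u = f w" if "(v, u) \<in> ?G" "(v, w) \<in> ?G" for u w
    proof -
      have uw: "u \<in> W" "w \<in> W" "u \<noteq> v" "w \<noteq> v"
        using that v W_closed by (auto simp: two_edges_def)
      have "(r, r) \<in> ?G ^^ (dist u + (1 + (1 + dist w)))"
      proof -
        have "(w, r) \<in> ?G ^^ dist w" using relpow_sym[OF dist] uw sym_two_edges by metis
        moreover have "(u, v) \<in> ?G ^^ 1" "(v, w) \<in> ?G ^^ 1" using that sym_two_edges by auto
        ultimately show ?thesis using dist[OF uw(1)] unfolding relpow_add by blast
      qed
      then have "even (dist u + (1 + (1 + dist w)))" using closed_walk_even[OF assms(1)] by blast
      then show ?thesis using parity uw by auto
    qed
    \<comment> \<open>The colour opposite to that of all neighbours of \<open>v\<close>; without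
      neighbours it is False, where either colour would do.\<close>
    define b where "b = (\<exists>u. (v, u) \<in> ?G \<and> \<not> f u)"
    have b: "f u \<longleftrightarrow> \<not> b" if "(v, u) \<in> ?G" for u
      using that same unfolding b_def by blast
    show ?thesis
    proof (intro exI[of _ "f(v := b)"] allI impI)
      fix e assume ge2: "2 \<le> card {w\<in>V. inc w e}"
      show "(\<exists>u\<in>V. inc u e \<and> (f(v := b)) u) \<and> (\<exists>w\<in>V. inc w e \<and> \<not> (f(v := b)) w)"
      proof (cases "card {w\<in>V - {v}. inc w e} \<ge> 2")
        case True
        from f[OF this] show ?thesis by auto
      next
        case less2: False
        \<comment> \<open>Deleting \<open>v\<close> brought the edge below two vertices, so it
          consists of \<open>v\<close> and one neighbour.\<close>
        have eq: "{w\<in>V - {v}. inc w e} = {w\<in>V. inc w e} - {v}" by auto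
        have "inc v e"
        proof (rule ccontr)
          assume "\<not> inc v e"
          then have "{w\<in>V. inc w e} - {v} = {w\<in>V. inc w e}" by auto
          with less2 ge2 eq show False by simp
        qed
        then have vin: "v \<in> {w\<in>V. inc w e}" using v \<open>W \<subseteq> V\<close> by auto
        then have "card {w\<in>V. inc w e} = 2"
          using less2 ge2 eq psubset.hyps by (simp add: card_Diff_singleton)
        then obtain u where u: "{w\<in>V. inc w e} = {v, u}" "u \<noteq> v"
          using vin unfolding card_2_iff by (metis doubleton_eq_iff insert_iff singletonD)
        then have "(v, u) \<in> ?G" by (auto simp: two_edges_def)
        from b[OF this] have "f u \<longleftrightarrow> \<not> b" .
        moreover have "inc v e" "inc u e" "v \<in> V" "u \<in> V" using u(1) by blast+
        ultimately show ?thesis using u(2) by (cases b) (auto simp: Bex_def)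
      qed
    qed
  qed
qed

text \<open>
  A colouring with the maximal total number of colours seen by the edges is good: otherwise recolour
  the union of a repeated and a missing colour class with \<open>two_colouring\<close>.
\<close>

lemma good_colouring:
  fixes inc :: "'v \<Rightarrow> 'e::finite \<Rightarrow> bool"
  assumes "\<And>k x E. \<not> odd_cycle inc k x E" "finite V" "s > 0"
  shows "\<exists>f :: 'v \<Rightarrow> nat. f ` V \<subseteq> {..<s} \<and>
           (\<forall>e. card {v\<in>V. inc v e} \<ge> s \<longrightarrow> {..<s} \<subseteq> f ` {v\<in>V. inc v e})"
proof -
  let ?E = "\<lambda>e. {v\<in>V. inc v e}"
  define val where "val f = (\<Sum>e\<in>UNIV. card (f ` ?E e))" for f :: "'v \<Rightarrow> nat"
  have "val f \<le> (\<Sum>e\<in>UNIV. card (?E e))" for f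
    unfolding val_def using assms(2) by (intro sum_mono card_image_le) auto
  then have bounded: "\<forall>f. f ` V \<subseteq> {..<s} \<longrightarrow> val f < Suc (\<Sum>e\<in>UNIV. card (?E e))"
    by (simp add: less_Suc_eq_le)
  have "(\<lambda>_. 0) ` V \<subseteq> {..<s}" using assms(3) by auto
  then obtain f where f: "f ` V \<subseteq> {..<s}"
    and max: "\<And>g. g ` V \<subseteq> {..<s} \<Longrightarrow> val g \<le> val f"
    using ex_has_greatest_nat[OF _ bounded] by metis
  have "{..<s} \<subseteq> f ` ?E e" if ge: "card (?E e) \<ge> s" for e
  proof (rule ccontr)
    assume "\<not> {..<s} \<subseteq> f ` ?E e"
    then obtain q where q: "q < s" "q \<notin> f ` ?E e" by auto
    have fin: "finite (?E e)" for e using assms(2) by auto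
    have "f ` ?E e \<subset> {..<s}" using q f by auto
    \<comment> \<open>The edge has at least \<open>s\<close> vertices but sees fewer than
      \<open>s\<close> colours, so some colour is repeated on it.\<close>
    then have "card (f ` ?E e) < s"
      using psubset_card_mono[of "{..<s}" "f ` ?E e"] by auto
    then have "\<not> inj_on f (?E e)" using ge card_image by fastforce
    then obtain u w where uw: "u \<in> ?E e" "w \<in> ?E e" "u \<noteq> w" "f u = f w"
      unfolding inj_on_def by blast
    define p where "p = f u"
    have p: "p < s" "p \<noteq> q" using uw q f by (auto simp: p_def)
    define U where "U = {v\<in>V. f v = p \<or> f v = q}"
    have "finite U" using assms(2) by (auto simp: U_def)
    then obtain g :: "'v \<Rightarrow> bool" where
      g: "\<And>e. card {v\<in>U. inc v e} \<ge> 2 \<Longrightarrow>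
           (\<exists>u\<in>U. inc u e \<and> g u) \<and> (\<exists>w\<in>U. inc w e \<and> \<not> g w)"
      using two_colouring[OF assms(1)] by metis
    define h where "h v = (if v \<in> U then if g v then p else q else f v)" for v
    have "h ` V \<subseteq> {..<s}" using f p q by (auto simp: h_def)
    have other: "f ` ?E e' - {p, q} \<subseteq> h ` ?E e' - {p, q}" for e'
    proof
      fix c assume "c \<in> f ` ?E e' - {p, q}"
      then obtain v where "v \<in> ?E e'" "c = f v" "v \<notin> U" "c \<notin> {p, q}" by (auto simp: U_def)
      then show "c \<in> h ` ?E e' - {p, q}" by (auto simp: h_def)
    qed
    have both: "{p, q} \<subseteq> h ` ?E e'" if ge2: "card {v\<in>U. inc v e'} \<ge> 2" for e'
    proof -
      obtain a b where "a \<in> U" "inc a e'" "g a" "b \<in> U" "inc b e'" "\<not> g b"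
        using g[OF ge2] by blast
      then have ab: "h a = p" "h b = q" "a \<in> ?E e'" "b \<in> ?E e'" by (auto simp: h_def U_def)
      have "p \<in> h ` ?E e'" using imageI[OF ab(3), of h] unfolding ab(1) .
      moreover have "q \<in> h ` ?E e'" using imageI[OF ab(4), of h] unfolding ab(2) .
      ultimately show ?thesis by simp
    qed
    \<comment> \<open>After recolouring, an edge with two vertices in \<open>U\<close> sees both
      \<open>p\<close> and \<open>q\<close>; one with a single vertex in \<open>U\<close> sees
      exactly one of them, as before; one disjoint from \<open>U\<close> is unchanged.\<close>
    have mono: "card (f ` ?E e') \<le> card (h ` ?E e')" for e'
    proof (cases "card {v\<in>U. inc v e'} \<ge> 2")
      case True
      then have "f ` ?E e' \<subseteq> h ` ?E e'" using other[of e'] both[of e'] by blast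
      then show ?thesis using fin by (intro card_mono) auto
    next
      case False
      have finU: "finite {v\<in>U. inc v e'}" using \<open>finite U\<close> by auto
      show ?thesis
      proof (cases "{v\<in>U. inc v e'} = {}")
        case True
        then have "v \<notin> U" if "v \<in> ?E e'" for v using that by blast
        then have "f ` ?E e' = h ` ?E e'" by (intro image_cong refl) (simp only: h_def if_False)
        then show ?thesis by simp
      next
        case ne: False
        then have "card {v\<in>U. inc v e'} \<noteq> 0" using finU by (simp only: card_0_eq) simp
        then have "card {v\<in>U. inc v e'} = 1" using False by linarith
        then obtain z where z: "{v\<in>U. inc v e'} = {z}" by (auto simp: card_1_singleton_iff)
        have zU: "z \<in> U" "z \<in> ?E e'" "inc z e'" using z by (auto simp: U_def)
        have "f ` ?E e' \<inter> {p, q} \<subseteq> {f z}"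
        proof
          fix c assume "c \<in> f ` ?E e' \<inter> {p, q}"
          then obtain v where "v \<in> ?E e'" "c = f v" "v \<in> U" by (auto simp: U_def)
          then have "v \<in> {v\<in>U. inc v e'}" by auto
          then show "c \<in> {f z}" using z \<open>c = f v\<close> by auto
        qed
        then have sub: "f ` ?E e' \<subseteq> insert (f z) (f ` ?E e' - {p, q})" by blast
        have "card (f ` ?E e') \<le> card (insert (f z) (f ` ?E e' - {p, q}))"
          using sub fin by (intro card_mono) auto
        also have "\<dots> \<le> Suc (card (f ` ?E e' - {p, q}))"
          by (rule card_insert_le_m1) auto
        also have "\<dots> \<le> Suc (card (h ` ?E e' - {p, q}))"
          using other fin by (intro Suc_le_mono[THEN iffD2] card_mono) auto
        also have "\<dots> = card (insert (h z) (h ` ?E e' - {p, q}))"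
          using fin zU by (subst card_insert_disjoint) (auto simp: h_def)
        also have "\<dots> \<le> card (h ` ?E e')"
          using fin zU by (intro card_mono) auto
        finally show ?thesis .
      qed
    qed
    \<comment> \<open>Both \<open>u\<close> and \<open>w\<close> lie in \<open>U\<close>, so
      \<open>e\<close> now sees both colours and gains \<open>q\<close>.\<close>
    have "card (f ` ?E e) < card (h ` ?E e)"
    proof -
      have "{u, w} \<subseteq> {v\<in>U. inc v e}" using uw by (auto simp: U_def p_def)
      then have "card {u, w} \<le> card {v\<in>U. inc v e}" using \<open>finite U\<close> by (intro card_mono) auto
      then have "card {v\<in>U. inc v e} \<ge> 2" using uw(3) by simp
      then have b: "{p, q} \<subseteq> h ` ?E e" by (rule both)
      then have "f ` ?E e \<subseteq> h ` ?E e" using other[of e] by blast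
      moreover have "q \<in> h ` ?E e" using b by blast
      ultimately have "f ` ?E e \<subset> h ` ?E e" using q(2) by blast
      then show ?thesis using fin by (intro psubset_card_mono) auto
    qed
    then have "val f < val h"
      unfolding val_def by (intro sum_strict_mono_ex1) (use mono in \<open>simp_all, blast\<close>)
    with max[OF \<open>h ` V \<subseteq> {..<s}\<close>] show False by simp
  qed
  with f show ?thesis by blast
qed

section \<open>Balanced matrices as hypergraphs without odd cycles\<close>

lemma odd_cycle_comp:
  "odd_cycle (\<lambda>v. inc (g v)) k x E \<Longrightarrow> odd_cycle inc k (\<lambda>i. g (x i)) E"
  by (simp add: odd_cycle_def)

text \<open>The rows and columns of an odd cycle cut out a submatrix in which row \<open>x i\<close>
  meets the columns of index \<open>i\<close> and its cyclic predecessor, and column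
  \<open>E j\<close> the rows of index \<open>j\<close> and its successor: the configuration that
  balancedness forbids.\<close>

lemma balanced_matrix_no_odd_cycle:
  fixes A :: "nat ^ 'q ^ 'n"
  assumes "balanced_matrix A"
  shows "\<not> odd_cycle (\<lambda>k j. A $ k $ j = 1) k x E"
proof
  assume "odd_cycle (\<lambda>k j. A $ k $ j = 1) k x E"
  then have k: "odd k" "k \<ge> 3"
    and inc: "\<And>i j. i < k \<Longrightarrow> j < k \<Longrightarrow> A $ x i $ E j = 1 \<longleftrightarrow> i = j \<or> i = Suc j mod k"
    unfolding odd_cycle_def by auto
  have Suc_mod: "Suc i mod k = (if Suc i = k then 0 else Suc i)" if "i < k" for i
    using that by auto
  \<comment> \<open>As \<open>k >= 3\<close>, two indices are never cyclic successors of each other.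
    Equal rows or equal columns would force this, so the submatrix really has size
    \<open>k\<close>.\<close>
  have no_swap: False if "i = Suc j mod k" "j = Suc i mod k" "i < k" "j < k" for i j
    using that k by (auto simp: Suc_mod split: if_splits)
  have inj_x: "inj_on x {..<k}"
  proof (rule inj_onI)
    fix i j assume ij: "i \<in> {..<k}" "j \<in> {..<k}" and eq: "x i = x j"
    show "i = j"
      using inc[of i i] inc[of j i] inc[of i j] inc[of j j] ij eq no_swap[of i j] by auto
  qed
  have inj_E: "inj_on E {..<k}"
  proof (rule inj_onI)
    fix i j assume ij: "i \<in> {..<k}" "j \<in> {..<k}" and eq: "E i = E j"
    show "i = j"
      using inc[of i i] inc[of i j] inc[of j i] inc[of j j] ij eq no_swap[of i j] by auto
  qed
  have "card {j\<in>E ` {..<k}. A $ r $ j = 1} = 2" if r: "r \<in> x ` {..<k}" for r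
  proof -
    obtain i where i: "i < k" "r = x i" using r by auto
    define i' where "i' = (if i = 0 then k - 1 else i - 1)"
    have i': "i' < k" "i' \<noteq> i" using i k by (auto simp: i'_def)
    have pred: "i = Suc j mod k \<longleftrightarrow> j = i'" if "j < k" for j
      using that i k by (cases "Suc j = k") (auto simp: i'_def)
    have "{j\<in>E ` {..<k}. A $ r $ j = 1} = E ` {j\<in>{..<k}. i = j \<or> i = Suc j mod k}"
      using inc i by auto
    also have "{j\<in>{..<k}. i = j \<or> i = Suc j mod k} = {i, i'}"
      using i i' pred by auto
    also have "card (E ` {i, i'}) = card {i, i'}"
      using i i' by (intro card_image inj_on_subset[OF inj_E]) auto
    finally show ?thesis using i' by simp
  qed
  moreover have "card {r\<in>x ` {..<k}. A $ r $ e = 1} = 2" if e: "e \<in> E ` {..<k}" for e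
  proof -
    obtain j where j: "j < k" "e = E j" using e by auto
    have "{r\<in>x ` {..<k}. A $ r $ e = 1} = x ` {i\<in>{..<k}. i = j \<or> i = Suc j mod k}"
      using inc j by auto
    also have "{i\<in>{..<k}. i = j \<or> i = Suc j mod k} = {j, Suc j mod k}"
      using j by (auto simp: Suc_mod)
    also have "card (x ` {j, Suc j mod k}) = card {j, Suc j mod k}"
      using j by (intro card_image inj_on_subset[OF inj_x]) (auto simp: Suc_mod)
    also have "\<dots> = 2" using j k by (auto simp: Suc_mod)
    finally show ?thesis .
  qed
  moreover have "card (x ` {..<k}) = k" "card (E ` {..<k}) = k"
    using inj_x inj_E by (auto simp: card_image)
  ultimately have "\<exists>R C. card R = card C \<and> odd (card R) \<and> card R \<ge> 3 \<and>
            (\<forall>i\<in>R. card {j\<in>C. A $ i $ j = 1} = 2) \<and>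
            (\<forall>j\<in>C. card {i\<in>R. A $ i $ j = 1} = 2)"
    using k by (intro exI[of _ "x ` {..<k}"] exI[of _ "E ` {..<k}"]) simp
  with assms show False unfolding balanced_matrix_def by blast
qed


section \<open>Integral coverings and packings\<close>

text \<open>The vertices are \<open>m k\<close> copies of each row \<open>k\<close>. Every column in
  \<open>J\<close> contains at least \<open>s\<close> copies, so a good colouring with
  \<open>s\<close> colours splits \<open>m\<close> into \<open>s\<close> covers, and the cheapest of
  them costs at most the average.\<close>

lemma colour_class_cover:
  fixes A :: "nat ^ 'q ^ 'n" and m w :: "'n \<Rightarrow> nat"
  assumes "balanced_matrix A" "s > 0" "\<And>j. j \<in> J \<Longrightarrow> (\<Sum>k\<in>UNIV. m k * A $ k $ j) \<ge> s"
  shows "\<exists>c :: 'n \<Rightarrow> nat. (\<forall>j\<in>J. (\<Sum>k\<in>UNIV. c k * A $ k $ j) \<ge> 1) \<and>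
           s * (\<Sum>k\<in>UNIV. w k * c k) \<le> (\<Sum>k\<in>UNIV. w k * m k)"
proof -
  define V where "V = Sigma UNIV (\<lambda>k. {..<m k})"
  define inc where "inc v j = (A $ fst v $ j = 1)" for v :: "'n \<times> nat" and j
  have "finite V" by (auto simp: V_def)
  have "\<not> odd_cycle inc k x E" for k x E
  proof
    assume "odd_cycle inc k x E"
    then have "odd_cycle (\<lambda>v j. A $ fst v $ j = 1) k x E"
      unfolding odd_cycle_def inc_def by blast
    from odd_cycle_comp[where inc = "\<lambda>k j. A $ k $ j = 1" and g = fst, OF this]
    show False using balanced_matrix_no_odd_cycle[OF assms(1)] by blast
  qed
  from good_colouring[where inc = inc, OF this \<open>finite V\<close> assms(2)]
  obtain f where f: "f ` V \<subseteq> {..<s}"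
    and good: "\<And>e. card {v\<in>V. inc v e} \<ge> s \<Longrightarrow> {..<s} \<subseteq> f ` {v\<in>V. inc v e}" by blast
  have card_edge: "card {v\<in>V. inc v j} = (\<Sum>k\<in>UNIV. m k * A $ k $ j)" for j
  proof -
    have "{v\<in>V. inc v j} = Sigma UNIV (\<lambda>k. if A $ k $ j = 1 then {..<m k} else {})"
      by (auto simp: V_def inc_def split: if_splits)
    also have "card \<dots> = (\<Sum>k\<in>UNIV. card (if A $ k $ j = 1 then {..<m k} else {}))"
      by (subst card_SigmaI) auto
    also have "\<dots> = (\<Sum>k\<in>UNIV. m k * A $ k $ j)"
    proof (intro sum.cong refl)
      fix k
      have "A $ k $ j \<in> {0, 1}" using assms(1) by (auto simp: balanced_matrix_def)
      then show "card (if A $ k $ j = 1 then {..<m k} else {}) = m k * A $ k $ j" by auto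
    qed
    finally show ?thesis .
  qed
  define c where "c i k = card {a\<in>{..<m k}. f (k, a) = i}" for i k
  have sum_c: "(\<Sum>i<s. c i k) = m k" for k
  proof -
    have "(\<Sum>i<s. c i k) = card (\<Union>i\<in>{..<s}. {a\<in>{..<m k}. f (k, a) = i})"
      unfolding c_def by (subst card_UN_disjoint) auto
    also have "(\<Union>i\<in>{..<s}. {a\<in>{..<m k}. f (k, a) = i}) = {..<m k}"
      using f by (force simp: V_def)
    finally show ?thesis by simp
  qed
  have cover: "(\<Sum>k\<in>UNIV. c i k * A $ k $ j) \<ge> 1" if "i < s" "j \<in> J" for i j
  proof -
    have "i \<in> f ` {v\<in>V. inc v j}" using good[of j] assms(3) that card_edge by auto
    then obtain k a where ka: "a < m k" "A $ k $ j = 1" "f (k, a) = i"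
      by (auto simp: V_def inc_def)
    have "a \<in> {a\<in>{..<m k}. f (k, a) = i}" using ka by simp
    then have "c i k \<noteq> 0" unfolding c_def by (subst card_0_eq) auto
    then have "1 \<le> c i k * A $ k $ j" using ka by simp
    also have "\<dots> \<le> (\<Sum>k\<in>UNIV. c i k * A $ k $ j)" by (rule member_le_sum) auto
    finally show ?thesis .
  qed
  define cost where "cost i = (\<Sum>k\<in>UNIV. w k * c i k)" for i
  obtain i where i: "i < s" "\<And>i'. i' < s \<Longrightarrow> cost i \<le> cost i'"
    using ex_has_least_nat[of "\<lambda>i. i < s" 0 cost] assms(2) by auto
  have "s * cost i \<le> (\<Sum>i'<s. cost i')"
    using sum_bounded_below[of "{..<s}" "cost i" cost] i by simp
  also have "\<dots> = (\<Sum>k\<in>UNIV. \<Sum>i'<s. w k * c i' k)" unfolding cost_def by (rule sum.swap)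
  also have "\<dots> = (\<Sum>k\<in>UNIV. w k * m k)" by (simp add: sum_c flip: sum_distrib_left)
  finally show ?thesis using cover i(1) unfolding cost_def by blast
qed

text \<open>Scaling \<open>x\<close> by a large \<open>s\<close>, rounding up and passing to a
  cheapest colour class gives an integral cover whose cost exceeds that of \<open>x\<close> by at
  most \<open>W / s\<close>. Since the cost is an integer, a small enough excess is no
  excess.\<close>

lemma integer_cover:
  fixes A :: "nat ^ 'q ^ 'n" and w :: "'n \<Rightarrow> nat" and x :: "'n \<Rightarrow> real"
  assumes "balanced_matrix A" "\<And>k. x k \<ge> 0"
    and "\<And>j. j \<in> J \<Longrightarrow> (\<Sum>k\<in>UNIV. x k * A $ k $ j) \<ge> 1"
  shows "\<exists>c :: 'n \<Rightarrow> nat. (\<forall>j\<in>J. (\<Sum>k\<in>UNIV. c k * A $ k $ j) \<ge> 1) \<and>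
           real (\<Sum>k\<in>UNIV. w k * c k) \<le> (\<Sum>k\<in>UNIV. w k * x k)"
proof -
  define T where "T = (\<Sum>k\<in>UNIV. w k * x k)"
  define W where "W = (\<Sum>k\<in>UNIV. w k)"
  \<comment> \<open>The distance is taken to floor plus one rather than to the ceiling, so that it
    is positive also for integral \<open>T\<close>. Below, \<open>s\<close> is chosen with
    \<open>W / s < gap\<close>.\<close>
  define gap where "gap = of_int (\<lfloor>T\<rfloor> + 1) - T"
  have "gap > 0" unfolding gap_def by linarith
  obtain s :: nat where "W / gap < s" using reals_Archimedean2 by blast
  moreover have "W / gap \<ge> 0" using \<open>gap > 0\<close> by simp
  ultimately have s: "s > 0" "W < s * gap"
    using \<open>gap > 0\<close> by (auto simp: field_simps intro: Nat.gr0I)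
  define m where "m k = nat \<lceil>s * x k\<rceil>" for k
  have m: "s * x k \<le> m k" "m k \<le> s * x k + 1" for k
    using assms(2)[of k] s(1) mult_nonneg_nonneg[of "real s" "x k"] unfolding m_def by linarith+
  have "(\<Sum>k\<in>UNIV. m k * A $ k $ j) \<ge> s" if "j \<in> J" for j
  proof -
    have "real s \<le> s * (\<Sum>k\<in>UNIV. x k * A $ k $ j)"
      using assms(3)[OF that] s(1) by simp
    also have "\<dots> = (\<Sum>k\<in>UNIV. s * x k * A $ k $ j)" by (simp add: sum_distrib_left mult.assoc)
    also have "\<dots> \<le> (\<Sum>k\<in>UNIV. real (m k) * A $ k $ j)"
      by (intro sum_mono mult_right_mono m) auto
    also have "\<dots> = real (\<Sum>k\<in>UNIV. m k * A $ k $ j)" by simp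
    finally show ?thesis by linarith
  qed
  from colour_class_cover[OF assms(1) s(1) this]
  obtain c :: "'n \<Rightarrow> nat" where c: "\<forall>j\<in>J. (\<Sum>k\<in>UNIV. c k * A $ k $ j) \<ge> 1"
    "s * (\<Sum>k\<in>UNIV. w k * c k) \<le> (\<Sum>k\<in>UNIV. w k * m k)" by blast
  have "s * real (\<Sum>k\<in>UNIV. w k * c k) \<le> real (\<Sum>k\<in>UNIV. w k * m k)"
    using c(2) by (metis of_nat_le_iff of_nat_mult)
  also have "\<dots> = (\<Sum>k\<in>UNIV. w k * real (m k))" by simp
  also have "\<dots> \<le> (\<Sum>k\<in>UNIV. w k * (s * x k + 1))" by (intro sum_mono mult_left_mono m) auto
  also have "\<dots> = s * T + W"
    by (simp add: T_def W_def distrib_left sum.distrib sum_distrib_left mult_ac)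
  also have "\<dots> < s * (of_int (\<lfloor>T\<rfloor> + 1))" using s(2) unfolding gap_def by (simp add: algebra_simps)
  finally have "real (\<Sum>k\<in>UNIV. w k * c k) < of_int (\<lfloor>T\<rfloor> + 1)" using s(1) by simp
  then have "int (\<Sum>k\<in>UNIV. w k * c k) < \<lfloor>T\<rfloor> + 1" by (metis of_int_less_iff of_int_of_nat_eq)
  then have "real (\<Sum>k\<in>UNIV. w k * c k) \<le> T"
    by (metis le_floor_iff of_int_of_nat_eq zle_add1_eq_le)
  then show ?thesis using c(1) unfolding T_def by blast
qed

text \<open>Linear programming duality by separation: if the pair of \<open>a\<close> and the
  objective \<open>- t\<close> were outside the cone of attainable pairs, a separating functional
  would be, after scaling, a cover of cost below \<open>t\<close>.\<close>

lemma farkas_packing: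
  fixes M :: "'n::finite \<Rightarrow> 'q::finite \<Rightarrow> real" and a :: "'n \<Rightarrow> real"
  assumes "\<And>k. a k \<ge> 0"
    and dual: "\<And>x. (\<And>k. x k \<ge> 0) \<Longrightarrow> (\<And>j. j \<in> J \<Longrightarrow> (\<Sum>k\<in>UNIV. x k * M k j) \<ge> 1) \<Longrightarrow>
           (\<Sum>k\<in>UNIV. a k * x k) \<ge> t"
  shows "\<exists>y. (\<forall>j. y j \<ge> 0) \<and> (\<forall>k. (\<Sum>j\<in>J. M k j * y j) \<le> a k) \<and> (\<Sum>j\<in>J. y j) \<ge> t"
proof -
  \<comment> \<open>The second component is minus the objective. The generators are the columns in
    \<open>J\<close>, the slack directions, and the direction that worsens the objective. Finiteness
    of \<open>S\<close> makes its conical hull \<open>K\<close> closed; \<open>C\<close> describes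
    the pairs that admit a packing.\<close>
  define S :: "((real ^ 'n) \<times> real) set" where
    "S = (\<lambda>j. (\<chi> k. M k j, - 1)) ` J \<union> range (\<lambda>k. (axis k 1, 0)) \<union> {(0, 1)}"
  define K where "K = convex_cone hull S"
  define C where "C = {p :: (real ^ 'n) \<times> real. \<exists>y. (\<forall>j. y j \<ge> 0) \<and>
     (\<forall>k. (\<Sum>j\<in>J. M k j * y j) \<le> fst p $ k) \<and> - (\<Sum>j\<in>J. y j) \<le> snd p}"
  have "S \<subseteq> C"
  proof
    fix p assume "p \<in> S"
    then consider j where "j \<in> J" "p = (\<chi> k. M k j, - 1)" | k where "p = (axis k 1, 0)" | "p = (0, 1)"
      unfolding S_def by auto
    then show "p \<in> C"
    proof cases
      case 1
      then show ?thesis unfolding C_def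
        by (intro CollectI exI[of _ "\<lambda>i. if i = j then 1 else 0"])
          (auto simp: if_distrib[of "\<lambda>x. _ * x"] cong: if_cong)
    qed (auto simp: C_def axis_def intro!: exI[of _ "\<lambda>_. 0"])
  qed
  moreover have "convex_cone C"
    unfolding convex_cone_iff
  proof (intro conjI allI ballI impI)
    show "0 \<in> C" unfolding C_def by (auto intro!: exI[of _ "\<lambda>_. 0"])
  next
    fix p p' assume "p \<in> C" "p' \<in> C"
    then obtain y y' where
      y: "\<And>j. y j \<ge> 0" "\<And>k. (\<Sum>j\<in>J. M k j * y j) \<le> fst p $ k" "- (\<Sum>j\<in>J. y j) \<le> snd p" and
      y': "\<And>j. y' j \<ge> 0" "\<And>k. (\<Sum>j\<in>J. M k j * y' j) \<le> fst p' $ k" "- (\<Sum>j\<in>J. y' j) \<le> snd p'"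
      unfolding C_def by auto
    have "(\<Sum>j\<in>J. M k j * (y j + y' j)) \<le> fst (p + p') $ k" for k
      using add_mono[OF y(2) y'(2)] by (simp add: distrib_left sum.distrib)
    have "- (\<Sum>j\<in>J. y j + y' j) \<le> snd (p + p')"
      using y(3) y'(3) by (simp add: sum.distrib)
    have "y j + y' j \<ge> 0" for j using y(1) y'(1) by simp
    show "p + p' \<in> C" unfolding C_def
      by (intro CollectI exI[of _ "\<lambda>j. y j + y' j"] conjI allI) fact+
  next
    fix p and c :: real assume "p \<in> C" "0 \<le> c"
    then obtain y where y: "\<And>j. y j \<ge> 0" "\<And>k. (\<Sum>j\<in>J. M k j * y j) \<le> fst p $ k"
      "- (\<Sum>j\<in>J. y j) \<le> snd p" and c: "0 \<le> c"
      unfolding C_def by auto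
    have "(\<Sum>j\<in>J. M k j * (c * y j)) \<le> fst (c *\<^sub>R p) $ k" for k
      using mult_left_mono[OF y(2) c] by (simp add: sum_distrib_left mult.left_commute)
    have "- (\<Sum>j\<in>J. c * y j) \<le> snd (c *\<^sub>R p)"
      using mult_left_mono[OF y(3) c] by (simp add: sum_distrib_left)
    have "c * y j \<ge> 0" for j using y(1) c by simp
    show "c *\<^sub>R p \<in> C" unfolding C_def
      by (intro CollectI exI[of _ "\<lambda>j. c * y j"] conjI allI) fact+
  qed
  ultimately have "K \<subseteq> C" unfolding K_def by (rule hull_minimal)
  have "((\<chi> k. a k), - t) \<in> K"
  proof (rule ccontr)
    assume notin: "((\<chi> k. a k), - t) \<notin> K"
    have "convex K" "closed K"
      unfolding K_def by (auto simp: convex_convex_cone_hull S_def intro!: closed_convex_cone_hull)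
    from separating_hyperplane_closed_point[OF this notin]
    obtain g b where g: "inner g ((\<chi> k. a k), - t) < b" "\<And>p. p \<in> K \<Longrightarrow> inner g p > b" by blast
    have "b < 0" using g(2)[of 0] convex_cone_hull_contains_0 unfolding K_def by force
    \<comment> \<open>A generator with negative value could be rescaled within \<open>K\<close> to
      have value exactly \<open>b\<close>, against strict separation.\<close>
    have nonneg: "inner g p \<ge> 0" if "p \<in> S" for p
    proof (rule ccontr)
      assume neg: "\<not> inner g p \<ge> 0"
      have "p \<in> K" using that unfolding K_def by (rule hull_inc)
      then have "(b / inner g p) *\<^sub>R p \<in> K"
        unfolding K_def by (rule convex_cone_hull_mul) (use \<open>b < 0\<close> neg in \<open>simp add: divide_nonpos_neg\<close>)
      from g(2)[OF this] show False using neg by simp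
    qed
    obtain x z where gxz: "g = (x, z)" by (cases g)
    have x: "x $ k \<ge> 0" for k
      using nonneg[of "(axis k 1, 0)"] unfolding S_def gxz by (auto simp: inner_axis)
    have z: "z \<ge> 0" using nonneg[of "(0, 1)"] unfolding S_def gxz by auto
    have xz: "(\<Sum>k\<in>UNIV. x $ k * M k j) \<ge> z" if "j \<in> J" for j
      using nonneg[of "(\<chi> k. M k j, - 1)"] that unfolding S_def gxz by (auto simp: inner_vec_def)
    have neg: "(\<Sum>k\<in>UNIV. a k * x $ k) < z * t"
      using g(1) \<open>b < 0\<close> unfolding gxz by (simp add: inner_vec_def mult.commute)
    show False
    proof (cases "z = 0")
      case True
      \<comment> \<open>Without a component in the objective direction \<open>x\<close> cannot be
        normalised to a cover, but nonnegativity of \<open>a\<close> and \<open>x\<close> already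
        contradicts separation.\<close>
      have "(\<Sum>k\<in>UNIV. a k * x $ k) \<ge> 0" using assms(1) x by (intro sum_nonneg) auto
      with neg True show False by simp
    next
      case False
      then have "z > 0" using z by simp
      have "(\<Sum>k\<in>UNIV. a k * (x $ k / z)) \<ge> t"
      proof (rule dual)
        fix j assume "j \<in> J"
        then have "(\<Sum>k\<in>UNIV. x $ k * M k j) / z \<ge> 1" using xz \<open>z > 0\<close> by simp
        then show "(\<Sum>k\<in>UNIV. x $ k / z * M k j) \<ge> 1" by (simp add: sum_divide_distrib)
      qed (use x \<open>z > 0\<close> in simp)
      then have "(\<Sum>k\<in>UNIV. a k * x $ k) / z \<ge> t" by (simp add: sum_divide_distrib)
      with neg \<open>z > 0\<close> show False by (simp add: field_simps)
    qed
  qed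
  with \<open>K \<subseteq> C\<close> have "((\<chi> k. a k), - t) \<in> C" by blast
  then show ?thesis unfolding C_def by auto
qed

text \<open>
  The optimum of the fractional packing problem is an integer, by \<open>farkas_packing\<close> and
  \<open>integer_cover\<close>; hence rounding down one coordinate at a time loses nothing.
\<close>

lemma integer_packing:
  fixes A :: "nat ^ 'q ^ 'n" and a :: "'n \<Rightarrow> nat" and y :: "'q \<Rightarrow> real" and t :: int
  assumes bal: "balanced_matrix A"
    and "\<And>j. y j \<ge> 0" "\<And>k. (\<Sum>j\<in>J. A $ k $ j * y j) \<le> a k" "(\<Sum>j\<in>J. y j) > t - 1"
  shows "\<exists>z :: 'q \<Rightarrow> nat. (\<forall>k. (\<Sum>j\<in>J. A $ k $ j * z j) \<le> a k) \<and> int (\<Sum>j\<in>J. z j) \<ge> t"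
proof -
  have "finite J" by simp
  then show ?thesis using assms(2-)
  proof (induction J arbitrary: a y t rule: finite_induct)
    case empty
    have "t \<le> 0" using empty.prems(3) by simp
    then show ?case by simp
  next
    case (insert j J)
    let ?J = "insert j J"
    \<comment> \<open>A fractional value above \<open>t - 1\<close> can be raised to
      \<open>t\<close>: a cover of cost below \<open>t\<close> could be replaced by an integral one,
      of cost at most \<open>t - 1\<close>, which weak duality with \<open>y\<close>
      excludes.\<close>
    have "\<exists>y. (\<forall>j. y j \<ge> 0) \<and> (\<forall>k. (\<Sum>j\<in>?J. real (A $ k $ j) * y j) \<le> real (a k)) \<and>
            (\<Sum>j\<in>?J. y j) \<ge> of_int t"
    proof (rule farkas_packing)
      fix x :: "'n \<Rightarrow> real"
      assume x: "\<And>k. x k \<ge> 0" "\<And>j. j \<in> ?J \<Longrightarrow> (\<Sum>k\<in>UNIV. x k * real (A $ k $ j)) \<ge> 1"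
      show "(\<Sum>k\<in>UNIV. real (a k) * x k) \<ge> of_int t"
      proof (rule ccontr)
        assume less: "\<not> (\<Sum>k\<in>UNIV. real (a k) * x k) \<ge> of_int t"
        have "\<exists>c :: 'n \<Rightarrow> nat. (\<forall>j\<in>?J. (\<Sum>k\<in>UNIV. c k * A $ k $ j) \<ge> 1) \<and>
            real (\<Sum>k\<in>UNIV. a k * c k) \<le> (\<Sum>k\<in>UNIV. real (a k) * x k)"
          by (rule integer_cover[OF bal x])
        then obtain c :: "'n \<Rightarrow> nat" where
          c: "\<forall>j\<in>?J. (\<Sum>k\<in>UNIV. c k * A $ k $ j) \<ge> 1" and
          ac: "real (\<Sum>k\<in>UNIV. a k * c k) \<le> (\<Sum>k\<in>UNIV. real (a k) * x k)"
          by (elim exE conjE)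
        have "real (\<Sum>k\<in>UNIV. a k * c k) < of_int t" using ac less by linarith
        then have "int (\<Sum>k\<in>UNIV. a k * c k) \<le> t - 1" by linarith
        then have "real (\<Sum>k\<in>UNIV. a k * c k) \<le> of_int t - 1" by linarith
        moreover have "(\<Sum>j\<in>?J. y j) \<le> real (\<Sum>k\<in>UNIV. a k * c k)"
        proof -
          have "(\<Sum>j\<in>?J. y j) \<le> (\<Sum>j\<in>?J. real (\<Sum>k\<in>UNIV. c k * A $ k $ j) * y j)"
          proof (rule sum_mono)
            fix j assume "j \<in> ?J"
            then have "1 \<le> (\<Sum>k\<in>UNIV. c k * A $ k $ j)" using c by (rule bspec[rotated])
            then have "1 \<le> real (\<Sum>k\<in>UNIV. c k * A $ k $ j)" by linarith
            from mult_right_mono[OF this insert.prems(1)]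
            show "y j \<le> real (\<Sum>k\<in>UNIV. c k * A $ k $ j) * y j" by simp
          qed
          also have "\<dots> = (\<Sum>j\<in>?J. \<Sum>k\<in>UNIV. real (c k) * (A $ k $ j * y j))"
            by (simp add: sum_distrib_right mult.assoc)
          also have "\<dots> = (\<Sum>k\<in>UNIV. \<Sum>j\<in>?J. real (c k) * (A $ k $ j * y j))" by (rule sum.swap)
          also have "\<dots> = (\<Sum>k\<in>UNIV. real (c k) * (\<Sum>j\<in>?J. A $ k $ j * y j))"
            by (simp only: sum_distrib_left)
          also have "\<dots> \<le> (\<Sum>k\<in>UNIV. real (c k) * real (a k))"
            by (intro sum_mono mult_left_mono insert.prems(2)) simp
          finally show ?thesis by (simp add: mult.commute)
        qed
        ultimately show False using insert.prems(3) by linarith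
      qed
    qed simp
    then obtain y' where y': "\<And>j. y' j \<ge> 0" "\<And>k. (\<Sum>j\<in>?J. real (A $ k $ j) * y' j) \<le> real (a k)"
      "(\<Sum>j\<in>?J. y' j) \<ge> of_int t" by blast
    \<comment> \<open>Column \<open>j\<close> is used \<open>n\<close> times and its share removed
      from the capacities. As \<open>y' j < n + 1\<close>, the other columns keep a value above
      \<open>(t - n) - 1\<close>, which is what the induction hypothesis asks for.\<close>
    define n where "n = nat \<lfloor>y' j\<rfloor>"
    have n: "real n \<le> y' j" "y' j < real n + 1" using y'(1)[of j] unfolding n_def by linarith+
    have cap: "(\<Sum>j\<in>J. real (A $ k $ j) * y' j) \<le> a k - real (n * A $ k $ j)" for k
    proof -
      have "real (A $ k $ j) * real n \<le> A $ k $ j * y' j" by (intro mult_left_mono n) simp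
      then show ?thesis using y'(2)[of k] insert.hyps by (simp add: mult.commute)
    qed
    \<comment> \<open>This makes the natural-number subtraction in the reduced capacities
      exact.\<close>
    have le: "n * A $ k $ j \<le> a k" for k
    proof -
      have "(\<Sum>j\<in>J. real (A $ k $ j) * y' j) \<ge> 0" using y'(1) by (intro sum_nonneg) simp
      with cap[of k] have "real (n * A $ k $ j) \<le> real (a k)" by linarith
      then show ?thesis by (simp only: of_nat_le_iff)
    qed
    have "\<exists>z :: 'q \<Rightarrow> nat. (\<forall>k. (\<Sum>j\<in>J. A $ k $ j * z j) \<le> a k - n * A $ k $ j) \<and>
            int (\<Sum>j\<in>J. z j) \<ge> t - int n"
    proof (rule insert.IH[OF y'(1)])
      show "(\<Sum>j\<in>J. real (A $ k $ j) * y' j) \<le> real (a k - n * A $ k $ j)" for k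
        using cap[of k] of_nat_diff[OF le[of k], where 'a = real] by linarith
      show "(\<Sum>j\<in>J. y' j) > of_int (t - int n - 1)"
        using y'(3) insert.hyps n(2) by simp
    qed
    then obtain z where z: "\<And>k. (\<Sum>j\<in>J. A $ k $ j * z j) \<le> a k - n * A $ k $ j"
      "int (\<Sum>j\<in>J. z j) \<ge> t - int n" by blast
    show ?case
    proof (intro exI[of _ "z(j := n)"] conjI allI)
      have "(\<Sum>i\<in>J. g i * (z(j := n)) i) = (\<Sum>i\<in>J. g i * z i)" for g :: "'q \<Rightarrow> nat"
        using insert.hyps by (intro sum.cong) auto
      then have split: "(\<Sum>i\<in>?J. g i * (z(j := n)) i) = g j * n + (\<Sum>i\<in>J. g i * z i)"
        for g :: "'q \<Rightarrow> nat"
        using insert.hyps by (subst sum.insert) simp_all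
      show "(\<Sum>i\<in>?J. A $ k $ i * (z(j := n)) i) \<le> a k" for k
        unfolding split using z(1)[of k] le[of k] by (simp add: mult.commute)
      show "t \<le> int (\<Sum>i\<in>?J. (z(j := n)) i)"
        using split[of "\<lambda>_. 1"] z(2) by simp
    qed
  qed
qed

text \<open>An integral packing with coefficient sum at least that of \<open>y\<close> has entry sum
  at least that of \<open>a\<close>, because each column contributes \<open>d\<close>. Lying below
  \<open>a\<close> coordinatewise, it equals \<open>a\<close>.\<close>

lemma uniform_nat_combination:
  fixes A :: "nat ^ 'q ^ 'n" and a :: "'n \<Rightarrow> nat" and y :: "'q \<Rightarrow> real"
  assumes "balanced_matrix A" "\<And>j. (\<Sum>k\<in>UNIV. A $ k $ j) = d" "d > 0"
    and "\<And>j. y j \<ge> 0" "\<And>k. a k = (\<Sum>j\<in>J. A $ k $ j * y j)"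
  shows "\<exists>z :: 'q \<Rightarrow> nat. \<forall>k. a k = (\<Sum>j\<in>J. A $ k $ j * z j)"
proof -
  \<comment> \<open>The ceiling satisfies both bounds in use: \<open>t - 1\<close> is below the
    fractional value, and \<open>t\<close> is at least that value.\<close>
  define t where "t = \<lceil>\<Sum>j\<in>J. y j\<rceil>"
  have "\<exists>z :: 'q \<Rightarrow> nat. (\<forall>k. (\<Sum>j\<in>J. A $ k $ j * z j) \<le> a k) \<and> int (\<Sum>j\<in>J. z j) \<ge> t"
  proof (rule integer_packing[OF assms(1,4)])
    show "(\<Sum>j\<in>J. y j) > of_int (t - 1)" unfolding t_def by linarith
  qed (simp add: assms(5))
  then obtain z :: "'q \<Rightarrow> nat" where
    z: "\<And>k. (\<Sum>j\<in>J. A $ k $ j * z j) \<le> a k" "int (\<Sum>j\<in>J. z j) \<ge> t" by blast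
  have total: "(\<Sum>k\<in>UNIV. \<Sum>j\<in>J. real (A $ k $ j) * f j) = d * (\<Sum>j\<in>J. f j)" for f :: "'q \<Rightarrow> real"
  proof -
    have "(\<Sum>k\<in>UNIV. \<Sum>j\<in>J. real (A $ k $ j) * f j) = (\<Sum>j\<in>J. \<Sum>k\<in>UNIV. real (A $ k $ j) * f j)"
      by (rule sum.swap)
    also have "\<dots> = (\<Sum>j\<in>J. real (\<Sum>k\<in>UNIV. A $ k $ j) * f j)" by (simp add: sum_distrib_right)
    finally show ?thesis by (simp add: assms(2) sum_distrib_left)
  qed
  have "real (\<Sum>k\<in>UNIV. a k) = d * (\<Sum>j\<in>J. y j)" by (simp add: assms(5) total)
  also have "\<dots> \<le> d * real (\<Sum>j\<in>J. z j)"
    using z(2) unfolding t_def by (intro mult_left_mono) linarith+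
  also have "\<dots> = real (\<Sum>k\<in>UNIV. \<Sum>j\<in>J. A $ k $ j * z j)"
    using total[of "\<lambda>j. real (z j)"] by simp
  finally have "(\<Sum>k\<in>UNIV. a k) \<le> (\<Sum>k\<in>UNIV. \<Sum>j\<in>J. A $ k $ j * z j)" by (simp only: of_nat_le_iff)
  moreover have "(\<Sum>k\<in>UNIV. \<Sum>j\<in>J. A $ k $ j * z j) \<le> (\<Sum>k\<in>UNIV. a k)" by (intro sum_mono z(1))
  ultimately have "(\<Sum>k\<in>UNIV. \<Sum>j\<in>J. A $ k $ j * z j) = (\<Sum>k\<in>UNIV. a k)" by (rule antisym[rotated])
  then have "\<forall>k. (\<Sum>j\<in>J. A $ k $ j * z j) = a k"
    using sum_mono_inv[of "\<lambda>k. \<Sum>j\<in>J. A $ k $ j * z j" UNIV a] z(1) by auto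
  then show ?thesis by metis
qed

text \<open>Adding a large multiple \<open>N\<close> of every column in \<open>J\<close> makes the
  coefficients nonnegative and keeps the target integral; \<open>N\<close> is subtracted from the
  resulting coefficients.\<close>

lemma uniform_int_combination:
  fixes A :: "nat ^ 'q ^ 'n" and a :: "'n \<Rightarrow> int" and y :: "'q \<Rightarrow> real"
  assumes "balanced_matrix A" "\<And>j. (\<Sum>k\<in>UNIV. A $ k $ j) = d" "d > 0"
    and "\<And>k. a k = (\<Sum>j\<in>J. A $ k $ j * y j)"
  shows "\<exists>z :: 'q \<Rightarrow> int. \<forall>k. a k = (\<Sum>j\<in>J. int (A $ k $ j) * z j)"
proof -
  define N where "N = nat \<lceil>\<Sum>j\<in>J. \<bar>y j\<bar>\<rceil>"
  \<comment> \<open>The value 0 outside \<open>J\<close> provides nonnegativity at all indices, as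
    \<open>uniform_nat_combination\<close> demands.\<close>
  define y' where "y' j = (if j \<in> J then y j + N else 0)" for j
  have y': "y' j \<ge> 0" for j
  proof (cases "j \<in> J")
    case True
    then have "\<bar>y j\<bar> \<le> (\<Sum>j\<in>J. \<bar>y j\<bar>)" by (intro member_le_sum) auto
    then have "y j + N \<ge> 0" unfolding N_def by linarith
    then show ?thesis using True by (simp add: y'_def)
  qed (simp add: y'_def)
  define b where "b k = a k + (\<Sum>j\<in>J. int (A $ k $ j) * int N)" for k
  have b: "of_int (b k) = (\<Sum>j\<in>J. A $ k $ j * y' j)" for k
  proof -
    have "(\<Sum>j\<in>J. A $ k $ j * y' j) = (\<Sum>j\<in>J. A $ k $ j * y j + A $ k $ j * N)"
      by (intro sum.cong) (auto simp: y'_def distrib_left)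
    then show ?thesis by (simp add: b_def assms(4) sum.distrib)
  qed
  have "b k \<ge> 0" for k
  proof -
    have "(\<Sum>j\<in>J. A $ k $ j * y' j) \<ge> 0" using y' by (intro sum_nonneg) simp
    then show ?thesis unfolding b[symmetric] by simp
  qed
  then have "real (nat (b k)) = (\<Sum>j\<in>J. A $ k $ j * y' j)" for k using b[of k] by simp
  from uniform_nat_combination[OF assms(1-3) y' this]
  obtain z :: "'q \<Rightarrow> nat" where z: "\<And>k. nat (b k) = (\<Sum>j\<in>J. A $ k $ j * z j)" by blast
  have "a k = (\<Sum>j\<in>J. int (A $ k $ j) * (int (z j) - int N))" for k
  proof -
    have "b k = int (\<Sum>j\<in>J. A $ k $ j * z j)" using z[of k] \<open>b k \<ge> 0\<close> by (metis int_nat_eq)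
    then have "a k = (\<Sum>j\<in>J. int (A $ k $ j) * int (z j)) - (\<Sum>j\<in>J. int (A $ k $ j) * int N)"
      by (simp add: b_def)
    then show ?thesis by (simp only: right_diff_distrib sum_subtractf)
  qed
  then show ?thesis by (intro exI[of _ "\<lambda>j. int (z j) - int N"] allI)
qed


section \<open>Full-dimensionality of the cones of a regular triangulation\<close>

text \<open>Up to sign \<open>l\<close> is a singular Z-matrix. A row with nonnegative diagonal
  entry serves by itself; eliminating an index with negative diagonal entry preserves both the sign
  pattern and the kernel vector.\<close>

lemma Z_matrix_nonneg_combination:
  fixes l :: "'i \<Rightarrow> 'i \<Rightarrow> int" and h :: "'i \<Rightarrow> real"
  assumes "finite I" "\<And>i j. i \<in> I \<Longrightarrow> j \<in> I \<Longrightarrow> i \<noteq> j \<Longrightarrow> l i j \<ge> 0"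
    and "\<And>i. i \<in> I \<Longrightarrow> (\<Sum>j\<in>I. l i j * h j) = 0" "\<exists>i\<in>I. h i \<noteq> 0"
  shows "\<exists>\<alpha> :: 'i \<Rightarrow> nat. (\<exists>i\<in>I. \<alpha> i > 0) \<and> (\<forall>j\<in>I. (\<Sum>i\<in>I. int (\<alpha> i) * l i j) \<ge> 0)"
  using assms
proof (induction I arbitrary: l rule: finite_induct)
  case empty
  then show ?case by simp
next
  case (insert k I)
  show ?case
  proof (cases "l k k \<ge> 0")
    case True
    have "(\<Sum>i\<in>insert k I. int (if i = k then 1 else 0) * l i j) = l k j" for j
      using insert.hyps by (simp add: if_distrib[of int] if_distrib[of "\<lambda>x. x * _"] cong: if_cong)
    moreover have "l k j \<ge> 0" if "j \<in> insert k I" for j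
      using True insert.prems(1)[of k j] that by (cases "j = k") auto
    ultimately have "(\<Sum>i\<in>insert k I. int (if i = k then 1 else 0) * l i j) \<ge> 0"
      if "j \<in> insert k I" for j using that by simp
    then show ?thesis by (intro exI[of _ "\<lambda>i. if i = k then 1 else 0"] conjI ballI bexI[of _ k]) simp_all
  next
    case False
    define p where "p = - l k k"
    have "p > 0" using False by (simp add: p_def)
    \<comment> \<open>Gaussian elimination of column \<open>k\<close>, with multiplication by
      \<open>p\<close> in place of division so that the entries stay integral.\<close>
    define l' where "l' i j = p * l i j + l i k * l k j" for i j
    have row: "(\<Sum>j\<in>I. l i j * h j) = - (l i k * h k)" if "i \<in> insert k I" for i
      using insert.prems(2)[OF that] insert.hyps by simp
    have nonneg: "l i k \<ge> 0" "l k i \<ge> 0" if "i \<in> I" for i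
      using insert.prems(1) insert.hyps that by auto
    have "\<exists>\<alpha> :: 'i \<Rightarrow> nat. (\<exists>i\<in>I. \<alpha> i > 0) \<and> (\<forall>j\<in>I. (\<Sum>i\<in>I. int (\<alpha> i) * l' i j) \<ge> 0)"
    proof (rule insert.IH)
      show "l' i j \<ge> 0" if "i \<in> I" "j \<in> I" "i \<noteq> j" for i j
        unfolding l'_def using insert.prems(1)[of i j] nonneg that \<open>p > 0\<close> by simp
      show "(\<Sum>j\<in>I. l' i j * h j) = 0" if "i \<in> I" for i
      proof -
        have "(\<Sum>j\<in>I. l' i j * h j) = p * (\<Sum>j\<in>I. l i j * h j) + l i k * (\<Sum>j\<in>I. l k j * h j)"
          by (simp add: l'_def sum_distrib_left sum.distrib algebra_simps)
        then show ?thesis using row that by (simp add: p_def)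
      qed
      show "\<exists>i\<in>I. h i \<noteq> 0"
      proof (rule ccontr)
        assume "\<not> (\<exists>i\<in>I. h i \<noteq> 0)"
        then have "h k \<noteq> 0" "(\<Sum>j\<in>I. l k j * h j) = 0" using insert.prems(3) by auto
        with row[of k] False show False by simp
      qed
    qed
    then obtain \<alpha> where \<alpha>: "\<exists>i\<in>I. \<alpha> i > 0" "\<And>j. j \<in> I \<Longrightarrow> (\<Sum>i\<in>I. int (\<alpha> i) * l' i j) \<ge> 0"
      by blast
    define c where "c = (\<Sum>i\<in>I. int (\<alpha> i) * l i k)"
    have "c \<ge> 0" unfolding c_def using nonneg by (intro sum_nonneg) simp
    \<comment> \<open>The weight \<open>c\<close> of row \<open>k\<close> makes column
      \<open>k\<close> cancel, as \<open>c * l k k + p * c = 0\<close>; on the other columns the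
      combination agrees with that of \<open>l'\<close> under \<alpha>.\<close>
    define \<beta> where "\<beta> i = (if i = k then nat c else nat p * \<alpha> i)" for i
    have comb: "(\<Sum>i\<in>insert k I. int (\<beta> i) * l i j) = c * l k j + p * (\<Sum>i\<in>I. int (\<alpha> i) * l i j)" for j
    proof -
      have "(\<Sum>i\<in>I. int (\<beta> i) * l i j) = (\<Sum>i\<in>I. p * (int (\<alpha> i) * l i j))"
        using insert.hyps \<open>p > 0\<close> by (intro sum.cong) (auto simp: \<beta>_def)
      then show ?thesis
        using insert.hyps \<open>c \<ge> 0\<close> by (simp add: \<beta>_def sum_distrib_left)
    qed
    have "(\<Sum>i\<in>insert k I. int (\<beta> i) * l i j) \<ge> 0" if "j \<in> insert k I" for j
    proof (cases "j = k")
      case True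
      then show ?thesis unfolding comb by (simp add: c_def p_def)
    next
      case False
      have "(\<Sum>i\<in>I. int (\<alpha> i) * l' i j) = c * l k j + p * (\<Sum>i\<in>I. int (\<alpha> i) * l i j)"
        by (simp add: l'_def c_def sum_distrib_left sum_distrib_right sum.distrib algebra_simps)
      then show ?thesis using \<alpha>(2)[of j] that False unfolding comb by simp
    qed
    moreover have "\<exists>i\<in>insert k I. \<beta> i > 0"
      using \<alpha>(1) insert.hyps \<open>p > 0\<close> by (auto simp: \<beta>_def)
    ultimately show ?thesis by blast
  qed
qed

section \<open>Monomials and their images under the toric map\<close>

lemma pmonom_add: "pmonom (a + b) = pmonom a * (pmonom b :: ('i, 'k::comm_semiring_1) polynomial)"
  by (simp add: pmonom_def mult_single)

lemma pmonom_0: "pmonom 0 = (1 :: ('i, 'k::comm_semiring_1) polynomial)"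
  by (simp add: pmonom_def)

lemma pmonom_sum:
  "finite X \<Longrightarrow> pmonom (sum f X) = (\<Prod>x\<in>X. pmonom (f x) :: ('i, 'k::comm_semiring_1) polynomial)"
  by (induction X rule: finite_induct) (simp_all add: pmonom_add pmonom_0)

lemma pmonom_power:
  "(pmonom a :: ('i, 'k::comm_semiring_1) polynomial) ^ n = pmonom (\<Sum>_<n. a)"
  by (simp add: pmonom_sum)

lemma pmonom_eq_prod:
  fixes m :: "'i::finite monomial"
  shows "pmonom m = (\<Prod>j\<in>UNIV. (pvar j :: ('i, 'k::comm_semiring_1) polynomial) ^ Poly_Mapping.lookup m j)"
proof -
  have "m = (\<Sum>j\<in>UNIV. \<Sum>_<Poly_Mapping.lookup m j. Poly_Mapping.single j 1)"
    by (rule poly_mapping_eqI) (simp add: lookup_sum lookup_single when_def if_distrib[of "\<lambda>x. _ * x"] cong: if_cong)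
  then have "pmonom m = (pmonom \<dots> :: ('i, 'k) polynomial)" by simp
  also have "\<dots> = (\<Prod>j\<in>UNIV. pvar j ^ Poly_Mapping.lookup m j)"
    by (simp add: pmonom_sum pvar_def)
  finally show ?thesis .
qed

text \<open>The additive map by which the toric map acts on exponents; two monomials differ by an
  element of the toric ideal exactly when they lie in the same fibre of it.\<close>

definition toric_exponent :: "('q::finite \<Rightarrow> nat ^ 'n) \<Rightarrow> 'q monomial \<Rightarrow> 'n monomial" where
  "toric_exponent v m = vec_exponent (\<chi> k. \<Sum>i\<in>UNIV. Poly_Mapping.lookup m i * v i $ k)"

lemma lookup_toric_exponent:
  "Poly_Mapping.lookup (toric_exponent v m) k = (\<Sum>i\<in>UNIV. Poly_Mapping.lookup m i * v i $ k)"
  by (simp add: toric_exponent_def lookup_vec_exponent)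

lemma toric_exponent_add: "toric_exponent v (a + b) = toric_exponent v a + toric_exponent v b"
  by (rule poly_mapping_eqI)
    (simp add: lookup_toric_exponent lookup_add distrib_right sum.distrib)

lemma toric_exponent_sum:
  "finite X \<Longrightarrow> toric_exponent v (sum f X) = (\<Sum>x\<in>X. toric_exponent v (f x))"
  by (rule poly_mapping_eqI)
    (simp add: lookup_toric_exponent lookup_sum sum_distrib_right sum.swap[of _ X])

lemma toric_map_single_eq:
  fixes v :: "'q::finite \<Rightarrow> nat ^ 'n"
  shows "toric_map v (Poly_Mapping.single m c) = Poly_Mapping.single (toric_exponent v m) (c :: 'k::field)"
proof -
  have "toric_exponent v m = (\<Sum>i\<in>UNIV. \<Sum>_<Poly_Mapping.lookup m i. vec_exponent (v i))"
    by (rule poly_mapping_eqI) (simp add: lookup_toric_exponent lookup_sum lookup_vec_exponent)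
  then have "(\<Prod>i\<in>UNIV. pmonom (vec_exponent (v i)) ^ Poly_Mapping.lookup m i) =
      (pmonom (toric_exponent v m) :: ('n, 'k) polynomial)"
    by (simp add: pmonom_sum)
  then show ?thesis
    by (simp add: toric_map_single pconst_def pmonom_def mult_single)
qed

text \<open>Hence membership in the toric ideal means that the coefficients sum to zero over each
  fibre of \<open>toric_exponent v\<close>.\<close>

lemma lookup_toric_map:
  fixes f :: "('q::finite, 'k::field) polynomial"
  shows "Poly_Mapping.lookup (toric_map v f) e =
    (\<Sum>m\<in>Poly_Mapping.keys f. Poly_Mapping.lookup f m when toric_exponent v m = e)"
proof -
  have "toric_map v f = (\<Sum>m\<in>Poly_Mapping.keys f. toric_map v (Poly_Mapping.single m (Poly_Mapping.lookup f m)))"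
    unfolding toric_map_def[of v f] by (simp add: toric_map_single)
  then show ?thesis
    by (simp add: toric_map_single_eq lookup_sum lookup_single)
qed

section \<open>Term orders and the monomials of the initial ideal\<close>

lemma term_order_add: "term_order r \<Longrightarrow> (a, b) \<in> r \<Longrightarrow> (a + u, b + u) \<in> r"
  by (auto simp: term_order_def)

lemma term_order_trans: "term_order r \<Longrightarrow> (a, b) \<in> r \<Longrightarrow> (b, c) \<in> r \<Longrightarrow> (a, c) \<in> r"
  unfolding term_order_def strict_linear_order_on_def by (meson transD)

lemma term_order_irrefl: "term_order r \<Longrightarrow> (a, a) \<notin> r"
  unfolding term_order_def strict_linear_order_on_def by (meson irreflD)

lemma term_order_add_cancel:
  assumes "term_order r" "(a + u, b + u) \<in> r"
  shows "(a, b) \<in> r"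
proof (rule ccontr)
  assume "(a, b) \<notin> r"
  moreover have "a \<noteq> b" using assms term_order_irrefl by auto
  ultimately have "(b, a) \<in> r"
    using assms(1) unfolding term_order_def strict_linear_order_on_def total_on_def by blast
  then have "(b + u, a + u) \<in> r" using assms(1) by (rule term_order_add[rotated])
  then show False using assms term_order_trans term_order_irrefl by blast
qed

lemma term_order_sum:
  assumes "term_order r" "finite X" "X \<noteq> {}" "\<And>x. x \<in> X \<Longrightarrow> (f x, g x) \<in> r"
  shows "(sum f X, sum g X) \<in> r"
  using assms(2-)
proof (induction X rule: finite_ne_induct)
  case (insert x X)
  have "(f x + sum f X, g x + sum f X) \<in> r"
    using assms(1) insert.prems by (intro term_order_add) auto
  moreover have "(sum f X + g x, sum g X + g x) \<in> r"
    using assms(1) insert by (intro term_order_add) auto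
  ultimately show ?case
    using insert.hyps term_order_trans[OF assms(1)] by (simp add: add.commute)
qed auto

text \<open>All other monomials of \<open>f\<close> are smaller than \<open>m\<close>. If none of
  them shared its fibre, the coefficient sum over that fibre would be the nonzero coefficient at
  \<open>m\<close>.\<close>

lemma initial_monomial_toric_ideal:
  fixes f :: "('q::finite, 'k::field) polynomial"
  assumes "f \<in> toric_ideal v" "is_initial_monomial r f m"
  shows "\<exists>u. (u, m) \<in> r \<and> toric_exponent v u = toric_exponent v m"
proof (rule ccontr)
  assume none: "\<nexists>u. (u, m) \<in> r \<and> toric_exponent v u = toric_exponent v m"
  have m: "m \<in> Poly_Mapping.keys f" "\<And>u. u \<in> Poly_Mapping.keys f \<Longrightarrow> u \<noteq> m \<Longrightarrow> (u, m) \<in> r"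
    using assms(2) by (auto simp: is_initial_monomial_def)
  have "(\<Sum>u\<in>Poly_Mapping.keys f. Poly_Mapping.lookup f u when toric_exponent v u = toric_exponent v m)
      = (\<Sum>u\<in>Poly_Mapping.keys f. if u = m then Poly_Mapping.lookup f u else 0)"
    using none m(2) by (intro sum.cong) (auto simp: when_def)
  also have "\<dots> \<noteq> 0" using m(1) by (simp add: in_keys_iff)
  finally show False
    using assms(1) lookup_toric_map[of v f "toric_exponent v m"] by (simp add: toric_ideal_def)
qed

text \<open>The witness is the binomial of \<open>m\<close> minus \<open>u\<close>, with initial
  monomial \<open>m\<close>.\<close>

lemma pmonom_mem_initial_ideal_toric_ideal:
  fixes v :: "'q::finite \<Rightarrow> nat ^ 'n"
  assumes "term_order r" "(u, m) \<in> r" "toric_exponent v u = toric_exponent v m"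
  shows "(pmonom m :: ('q, 'k::field) polynomial) \<in> initial_ideal r (toric_ideal v)"
proof -
  let ?f = "Poly_Mapping.single m 1 + Poly_Mapping.single u (- 1) :: ('q, 'k) polynomial"
  have "u \<noteq> m" using assms term_order_irrefl by blast
  then have "m \<in> Poly_Mapping.keys ?f" "Poly_Mapping.keys ?f \<subseteq> {m, u}"
    by (auto simp: in_keys_iff lookup_add lookup_single when_def split: if_splits)
  then have "is_initial_monomial r ?f m" using assms(2) by (auto simp: is_initial_monomial_def)
  moreover have "?f \<in> toric_ideal v"
    using assms(3) by (simp add: toric_ideal_def toric_map_add toric_map_single_eq flip: single_add)
  ultimately show ?thesis
    unfolding initial_ideal_def by (intro module.span_base[OF module_times]) blast
qed

text \<open>The polynomials all of whose monomials are non-minimal in their fibres form an ideal,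
  since a pair \<open>(u, b)\<close> can be shifted by any monomial; this ideal contains the
  generators.\<close>

lemma keys_initial_ideal_toric_ideal:
  fixes f :: "('q::finite, 'k::field) polynomial"
  assumes "term_order r" "f \<in> initial_ideal r (toric_ideal v)" "m \<in> Poly_Mapping.keys f"
  shows "\<exists>u. (u, m) \<in> r \<and> toric_exponent v u = toric_exponent v m"
proof -
  let ?P = "\<lambda>m. \<exists>u. (u, m) \<in> r \<and> toric_exponent v u = toric_exponent v m"
  define S where "S = {f :: ('q, 'k) polynomial. \<forall>m\<in>Poly_Mapping.keys f. ?P m}"
  have "is_ideal S"
    unfolding module.subspace_def[OF module_times]
  proof (intro conjI allI ballI)
    show "0 \<in> S" by (simp add: S_def)
  next
    fix f g assume "f \<in> S" "g \<in> S"
    then show "f + g \<in> S" using Poly_Mapping.keys_add[of f g] unfolding S_def by blast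
  next
    fix c f assume f: "f \<in> S"
    have "?P m" if "m \<in> Poly_Mapping.keys (c * f)" for m
    proof -
      obtain a b where ab: "m = a + b" "b \<in> Poly_Mapping.keys f"
        using \<open>m \<in> Poly_Mapping.keys (c * f)\<close> keys_mult[of c f] by blast
      then obtain u where "(u, b) \<in> r" "toric_exponent v u = toric_exponent v b"
        using f by (auto simp: S_def)
      then have "(u + a, b + a) \<in> r" "toric_exponent v (u + a) = toric_exponent v (b + a)"
        using term_order_add[OF assms(1)] by (auto simp: toric_exponent_add)
      then show ?thesis using ab(1) by (auto simp: add.commute)
    qed
    then show "c * f \<in> S" by (simp add: S_def)
  qed
  moreover have "{pmonom m |m. \<exists>f\<in>toric_ideal v. is_initial_monomial r f m} \<subseteq> S"
    using initial_monomial_toric_ideal by (fastforce simp: S_def pmonom_def)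
  ultimately have "initial_ideal r (toric_ideal v) \<subseteq> S"
    unfolding initial_ideal_def by (intro module.span_minimal[OF module_times])
  then show ?thesis using assms(2,3) by (auto simp: S_def)
qed

section \<open>Products of variables in prime ideals\<close>

lemma is_ideal_mult_left: "is_ideal p \<Longrightarrow> x \<in> p \<Longrightarrow> c * x \<in> p"
  by (simp add: module.subspace_def[OF module_times])

lemma is_ideal_prod:
  assumes "is_ideal p" "finite X" "x \<in> X" "f x \<in> p"
  shows "prod f X \<in> p"
proof -
  have "prod f X = prod f (X - {x}) * f x"
    using assms(2,3) by (simp add: prod.remove mult.commute)
  then show ?thesis using assms is_ideal_mult_left by metis
qed

lemma prime_ideal_prodD:
  assumes "prime_ideal p" "finite X" "prod f X \<in> p"
  shows "\<exists>x\<in>X. f x \<in> p"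
  using assms(2,3)
proof (induction X rule: finite_induct)
  case empty
  have "c \<in> p" for c
    using is_ideal_mult_left[of p 1 c] empty assms(1) by (simp add: prime_ideal_def)
  then show ?case using assms(1) by (auto simp: prime_ideal_def)
next
  case (insert x X)
  then show ?case using assms(1) by (auto simp: prime_ideal_def)
qed

lemma prime_ideal_pmonomD:
  fixes p :: "('i::finite, 'k::field) polynomial set"
  assumes "prime_ideal p" "pmonom m \<in> p"
  shows "\<exists>j. Poly_Mapping.lookup m j > 0 \<and> pvar j \<in> p"
proof -
  obtain j where j: "pvar j ^ Poly_Mapping.lookup m j \<in> p"
    using prime_ideal_prodD[OF assms(1) finite] assms(2) unfolding pmonom_eq_prod by blast
  then have "(\<Prod>_<Poly_Mapping.lookup m j. pvar j) \<in> p" by simp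
  from prime_ideal_prodD[OF assms(1) _ this] show ?thesis by (metis finite_lessThan lessThan_iff not_less0 gr0I)
qed

text \<open>
  The cones of the triangulation are full-dimensional. If a functional \<open>e\<close> vanished on the face \<open>J\<close>
  but not on all columns, combining one binomial for each non-face \<open>J \<union> {i}\<close>, by
  \<open>Z_matrix_nonneg_combination\<close>, would produce an initial monomial supported on \<open>J\<close>.
\<close>

lemma facet_spans:
  fixes v :: "'q::finite \<Rightarrow> nat ^ 'n" and e :: "'n \<Rightarrow> real"
    and \<P> :: "('q, 'k::field) polynomial set set"
  assumes r: "term_order r"
    and prime: "\<And>p. p \<in> \<P> \<Longrightarrow> prime_ideal p"
    and gen: "\<And>p. p \<in> \<P> \<Longrightarrow> \<exists>S. p = ideal_gen (pvar ` S)"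
    and rad: "\<Inter>\<P> = radical (initial_ideal r (toric_ideal v))"
    and irredundant: "\<Inter>(\<P> - {p}) \<noteq> radical (initial_ideal r (toric_ideal v))"
    and p: "p \<in> \<P>"
    and e: "\<And>j. pvar j \<notin> p \<Longrightarrow> (\<Sum>k\<in>UNIV. e k * v j $ k) = 0"
  shows "(\<Sum>k\<in>UNIV. e k * v i $ k) = 0"
proof (rule ccontr)
  assume nz: "(\<Sum>k\<in>UNIV. e k * v i $ k) \<noteq> 0"
  define I where "I = {j. pvar j \<in> p}"
  define h where "h j = (\<Sum>k\<in>UNIV. e k * v j $ k)" for j
  have ideal: "is_ideal q" if "q \<in> \<P>" for q using prime[OF that] by (simp add: prime_ideal_def)
  \<comment> \<open>A prime whose variables all lie in \<open>p\<close> would be contained in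
    \<open>p\<close> and make \<open>p\<close> redundant.\<close>
  have other: "\<exists>s. pvar s \<in> q \<and> s \<notin> I" if q: "q \<in> \<P>" "q \<noteq> p" for q
  proof (rule ccontr)
    assume "\<nexists>s. pvar s \<in> q \<and> s \<notin> I"
    then have sub: "pvar s \<in> p" if "pvar s \<in> q" for s using that by (auto simp: I_def)
    obtain S where S: "q = ideal_gen (pvar ` S)" using gen q by blast
    then have "pvar ` S \<subseteq> p" using sub module.span_base[OF module_times] by blast
    then have "q \<subseteq> p" unfolding S by (rule module.span_minimal[OF module_times _ ideal[OF p]])
    then have "\<Inter>(\<P> - {p}) = \<Inter>\<P>" using q p by blast
    with rad irredundant show False by simp
  qed
  \<comment> \<open>The product of variable \<open>i\<close> and all variables outside
    \<open>p\<close> lies in every prime of the decomposition, so a power of it lies in the initial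
    ideal. Among the variables in \<open>p\<close>, that power involves only variable
    \<open>i\<close>.\<close>
  have "\<exists>m u. (u, m) \<in> r \<and> toric_exponent v u = toric_exponent v m \<and>
          (\<forall>j\<in>I. j \<noteq> i \<longrightarrow> Poly_Mapping.lookup m j = 0)" if i: "i \<in> I" for i
  proof -
    let ?X = "insert i (- I)"
    let ?M = "\<Sum>j\<in>?X. Poly_Mapping.single j 1 :: 'q monomial"
    have "(\<Prod>j\<in>?X. pvar j) \<in> q" if "q \<in> \<P>" for q
    proof (cases "q = p")
      case True
      then show ?thesis using i p ideal by (intro is_ideal_prod[of _ _ i]) (auto simp: I_def)
    next
      case False
      with that other obtain s where "pvar s \<in> q" "s \<notin> I" by blast
      then show ?thesis using ideal that by (intro is_ideal_prod[of _ _ s]) auto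
    qed
    then have "pmonom ?M \<in> \<Inter>\<P>" by (simp add: pmonom_sum pvar_def)
    then obtain n where "(pmonom ?M :: ('q, 'k) polynomial) ^ n \<in> initial_ideal r (toric_ideal v)"
      unfolding rad radical_def by blast
    then have "(pmonom (\<Sum>_<n. ?M) :: ('q, 'k) polynomial) \<in> initial_ideal r (toric_ideal v)"
      by (simp only: pmonom_power)
    from keys_initial_ideal_toric_ideal[OF r this, of "\<Sum>_<n. ?M"]
    obtain u where "(u, \<Sum>_<n. ?M) \<in> r" "toric_exponent v u = toric_exponent v (\<Sum>_<n. ?M)"
      by (auto simp: pmonom_def)
    moreover have "Poly_Mapping.lookup (\<Sum>_<n. ?M) j = 0" if "j \<in> I" "j \<noteq> i" for j
      using that by (auto simp: lookup_sum lookup_single when_def)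
    ultimately show ?thesis by blast
  qed
  then obtain m u where mu: "\<And>i. i \<in> I \<Longrightarrow> (u i, m i) \<in> r"
    "\<And>i. i \<in> I \<Longrightarrow> toric_exponent v (u i) = toric_exponent v (m i)"
    "\<And>i j. i \<in> I \<Longrightarrow> j \<in> I \<Longrightarrow> j \<noteq> i \<Longrightarrow> Poly_Mapping.lookup (m i) j = 0"
    by metis
  \<comment> \<open>Off the diagonal \<open>l\<close> is nonnegative on \<open>I\<close> because
    \<open>m i\<close> vanishes there. Both monomials of a pair lie in one fibre and
    \<open>h\<close> vanishes outside \<open>I\<close>, so \<open>h\<close> is in the
    kernel.\<close>
  define l where "l i j = int (Poly_Mapping.lookup (u i) j) - int (Poly_Mapping.lookup (m i) j)" for i j
  have "\<exists>\<alpha> :: 'q \<Rightarrow> nat. (\<exists>i\<in>I. \<alpha> i > 0) \<and> (\<forall>j\<in>I. (\<Sum>i\<in>I. int (\<alpha> i) * l i j) \<ge> 0)"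
  proof (rule Z_matrix_nonneg_combination)
    show "\<exists>i\<in>I. h i \<noteq> 0" using nz e[of i] by (auto simp: h_def I_def)
    show "(\<Sum>j\<in>I. l i j * h j) = 0" if "i \<in> I" for i
    proof -
      have zero: "(\<Sum>j\<in>UNIV. l i j * real (v j $ k)) = 0" for k
      proof -
        have "(\<Sum>j\<in>UNIV. Poly_Mapping.lookup (u i) j * v j $ k) =
            (\<Sum>j\<in>UNIV. Poly_Mapping.lookup (m i) j * v j $ k)"
          using mu(2)[OF that] by (metis lookup_toric_exponent)
        then have "real (\<Sum>j\<in>UNIV. Poly_Mapping.lookup (u i) j * v j $ k) =
            real (\<Sum>j\<in>UNIV. Poly_Mapping.lookup (m i) j * v j $ k)" by simp
        then show ?thesis by (simp add: l_def left_diff_distrib sum_subtractf)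
      qed
      have "(\<Sum>j\<in>I. l i j * h j) = (\<Sum>j\<in>UNIV. l i j * h j)"
        using e by (intro sum.mono_neutral_left) (auto simp: h_def I_def)
      also have "\<dots> = (\<Sum>j\<in>UNIV. \<Sum>k\<in>UNIV. e k * (l i j * real (v j $ k)))"
        by (simp add: h_def sum_distrib_left mult_ac)
      also have "\<dots> = (\<Sum>k\<in>UNIV. \<Sum>j\<in>UNIV. e k * (l i j * real (v j $ k)))" by (rule sum.swap)
      also have "\<dots> = 0" by (simp add: zero flip: sum_distrib_left)
      finally show ?thesis .
    qed
  qed (simp_all add: l_def mu(3))
  then obtain \<alpha> :: "'q \<Rightarrow> nat" where \<alpha>: "\<exists>i\<in>I. \<alpha> i > 0"
    "\<And>j. j \<in> I \<Longrightarrow> (\<Sum>i\<in>I. int (\<alpha> i) * l i j) \<ge> 0" by blast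
  \<comment> \<open>Each \<open>i\<close> is repeated \<open>\<alpha> i\<close> times. As
    \<open>X\<close> is nonempty, the summed comparison of monomials remains strict.\<close>
  define X where "X = Sigma I (\<lambda>i. {..<\<alpha> i})"
  define U where "U = (\<Sum>x\<in>X. u (fst x))"
  define M where "M = (\<Sum>x\<in>X. m (fst x))"
  have X: "finite X" "X \<noteq> {}" using \<alpha>(1) by (auto simp: X_def)
  have UM: "(U, M) \<in> r" unfolding U_def M_def
    using mu(1) by (intro term_order_sum[OF r X]) (auto simp: X_def)
  have eq: "toric_exponent v U = toric_exponent v M" unfolding U_def M_def toric_exponent_sum[OF X(1)]
    using mu(2) by (intro sum.cong) (auto simp: X_def)
  have sum_X: "(\<Sum>x\<in>X. g (fst x)) = (\<Sum>i\<in>I. int (\<alpha> i) * g i)" for g :: "'q \<Rightarrow> int"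
    unfolding X_def by (subst sum.Sigma[symmetric, where g = "\<lambda>i _. g i", simplified split_def]) auto
  have le: "Poly_Mapping.lookup M j \<le> Poly_Mapping.lookup U j" if "j \<in> I" for j
  proof -
    have "(\<Sum>x\<in>X. l (fst x) j) \<ge> 0" using \<alpha>(2)[OF that] by (simp add: sum_X[of "\<lambda>i. l i j"])
    then show ?thesis unfolding U_def M_def l_def lookup_sum sum_subtractf
      by (simp flip: of_nat_sum)
  qed
  \<comment> \<open>The part of \<open>M\<close> on \<open>I\<close>, contained in \<open>U\<close>
    as well by \<open>le\<close>. Cancelling it leaves a monomial \<open>M - w\<close> of the
    initial ideal in variables outside \<open>p\<close>, which the prime \<open>p\<close> cannot
    contain.\<close>
  define w where "w = (\<Sum>j\<in>I. Poly_Mapping.single j (Poly_Mapping.lookup M j))"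
  have w: "Poly_Mapping.lookup w j = (if j \<in> I then Poly_Mapping.lookup M j else 0)" for j
    by (simp add: w_def lookup_sum lookup_single when_def)
  have "U = (U - w) + w" "M = (M - w) + w"
    by (rule poly_mapping_eqI, use le in \<open>simp add: lookup_add lookup_minus w\<close>)+
  then have UM': "(U - w, M - w) \<in> r" "toric_exponent v (U - w) = toric_exponent v (M - w)"
    using UM eq term_order_add_cancel[OF r] toric_exponent_add add_right_cancel by metis+
  have "(pmonom (M - w) :: ('q, 'k) polynomial) \<in> initial_ideal r (toric_ideal v)"
    by (rule pmonom_mem_initial_ideal_toric_ideal[OF r UM'])
  then have "(pmonom (M - w) :: ('q, 'k) polynomial) \<in> radical (initial_ideal r (toric_ideal v))"
    unfolding radical_def by (auto intro: exI[of _ 1])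
  then have "pmonom (M - w) \<in> p" using rad p by blast
  from prime_ideal_pmonomD[OF prime[OF p] this]
  obtain j where "Poly_Mapping.lookup (M - w) j > 0" "j \<in> I" by (auto simp: I_def)
  then show False by (simp add: lookup_minus w)
qed


section \<open>Unimodularity\<close>

text \<open>The component of column \<open>i\<close> orthogonal to the span of the columns in
  \<open>J\<close> is, by \<open>orth\<close>, orthogonal to column \<open>i\<close> itself and
  hence zero. Injectivity turns a sum over the set of columns into one over
  \<open>J\<close>.\<close>

lemma mem_span_columns:
  fixes v :: "'q::finite \<Rightarrow> nat ^ 'n"
  assumes "inj v"
    and orth: "\<And>e :: 'n \<Rightarrow> real. (\<And>j. j \<in> J \<Longrightarrow> (\<Sum>k\<in>UNIV. e k * v j $ k) = 0) \<Longrightarrow>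
           (\<Sum>k\<in>UNIV. e k * v i $ k) = 0"
  shows "\<exists>y :: 'q \<Rightarrow> real. \<forall>k. v i $ k = (\<Sum>j\<in>J. v j $ k * y j)"
proof -
  define rv :: "'q \<Rightarrow> real ^ 'n" where "rv j = (\<chi> k. real (v j $ k))" for j
  have inner_rv: "inner x (rv j) = (\<Sum>k\<in>UNIV. x $ k * v j $ k)" for x j
    by (simp add: rv_def inner_vec_def)
  have "inj rv" using assms(1) by (auto simp: inj_def rv_def vec_eq_iff)
  obtain a b where ab: "a \<in> span (rv ` J)" "\<And>w. w \<in> span (rv ` J) \<Longrightarrow> orthogonal b w" "rv i = a + b"
    using orthogonal_subspace_decomp_exists by blast
  have "inner b (rv j) = 0" if "j \<in> J" for j
    using ab(2)[of "rv j"] that by (auto simp: orthogonal_def span_base)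
  then have "inner b (rv i) = 0" unfolding inner_rv by (rule orth)
  moreover have "inner b a = 0" using ab(1,2) by (auto simp: orthogonal_def)
  ultimately have "b = 0" using ab(3) by (simp add: inner_add_right)
  then have "rv i \<in> span (rv ` J)" using ab by simp
  then obtain c where c: "rv i = (\<Sum>w\<in>rv ` J. c w *\<^sub>R w)" by (auto simp: span_finite)
  also have "\<dots> = (\<Sum>j\<in>J. c (rv j) *\<^sub>R rv j)"
    using \<open>inj rv\<close> by (subst sum.reindex) (auto intro: inj_on_subset)
  finally have "rv i $ k = (\<Sum>j\<in>J. c (rv j) * rv j $ k)" for k by (simp add: sum_component)
  then show ?thesis by (intro exI[of _ "\<lambda>j. c (rv j)"]) (simp add: rv_def mult.commute)
qed

theorem theorem2p4p6:
  fixes A :: "nat ^ 'q ^ 'n"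
    and d :: nat
    and \<T> :: "(nat ^ 'n) set set"
  assumes "balanced_matrix A"
    and "inj (\<lambda>i. column i A)"
    and "\<And>i. column i A \<noteq> 0"
    and "\<And>i. (\<Sum>k\<in>UNIV. column i A $ k) = d"
    and "regular_triangulation TYPE('k::field) (\<lambda>i. column i A) \<T>"
  shows "unimodular (range (\<lambda>i. column i A)) \<T>"
  unfolding unimodular_def
proof
  fix B assume "B \<in> \<T>"
  let ?v = "\<lambda>i. column i A"
  from assms(5) obtain r and \<P> :: "('q, 'k) polynomial set set" where
    r: "term_order r" and
    prime: "\<forall>p\<in>\<P>. prime_ideal p \<and> (\<exists>S. p = ideal_gen (pvar ` S))" and
    rad: "\<Inter>\<P> = radical (initial_ideal r (toric_ideal ?v))" and
    irredundant: "\<forall>p\<in>\<P>. \<Inter>(\<P> - {p}) \<noteq> radical (initial_ideal r (toric_ideal ?v))" and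
    \<T>: "\<T> = (\<lambda>p. {?v j |j. pvar j \<notin> p}) ` \<P>"
    unfolding regular_triangulation_def by (elim exE conjE)
  obtain p where p: "p \<in> \<P>" "B = {?v j |j. pvar j \<notin> p}" using \<open>B \<in> \<T>\<close> \<T> by blast
  define J where "J = {j. pvar j \<notin> p}"
  have B: "B = ?v ` J" using p(2) by (auto simp: J_def)
  have "d > 0"
  proof (rule gr0I)
    assume "d = 0"
    then have "column i A = 0" for i using assms(4)[of i] by (simp add: vec_eq_iff)
    with assms(3) show False by blast
  qed
  define iv :: "nat ^ 'n \<Rightarrow> int ^ 'n" where "iv u = (\<chi> k. int (u $ k))" for u
  have lattice: "lattice_gen C = module.span (*s) (iv ` C)" for C
    by (simp add: lattice_gen_def iv_def[abs_def])
  \<comment> \<open>Full-dimensionality makes the column a real combination of the columns in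
    \<open>J\<close>; balancedness and the constant column sum then yield an integral one.\<close>
  have "iv (?v i) \<in> module.span (*s) (iv ` B)" for i
  proof -
    have "\<exists>y :: 'q \<Rightarrow> real. \<forall>k. ?v i $ k = (\<Sum>j\<in>J. ?v j $ k * y j)"
    proof (rule mem_span_columns[OF assms(2)])
      fix e :: "'n \<Rightarrow> real" assume "\<And>j. j \<in> J \<Longrightarrow> (\<Sum>k\<in>UNIV. e k * ?v j $ k) = 0"
      then show "(\<Sum>k\<in>UNIV. e k * ?v i $ k) = 0"
        by (rule facet_spans[OF r _ _ rad irredundant[rule_format, OF p(1)] p(1), rotated -1])
          (use prime in \<open>simp_all add: J_def\<close>)
    qed
    then obtain y :: "'q \<Rightarrow> real" where y: "\<And>k. ?v i $ k = (\<Sum>j\<in>J. ?v j $ k * y j)" by blast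
    have "\<exists>z :: 'q \<Rightarrow> int. \<forall>k. int (A $ k $ i) = (\<Sum>j\<in>J. int (A $ k $ j) * z j)"
    proof (rule uniform_int_combination[OF assms(1) _ \<open>d > 0\<close>])
      show "(\<Sum>k\<in>UNIV. A $ k $ j) = d" for j using assms(4)[of j] by (simp add: column_def)
      show "real_of_int (int (A $ k $ i)) = (\<Sum>j\<in>J. real (A $ k $ j) * y j)" for k
        using y[of k] by (simp add: column_def)
    qed
    then obtain z :: "'q \<Rightarrow> int" where "\<And>k. int (A $ k $ i) = (\<Sum>j\<in>J. int (A $ k $ j) * z j)" by blast
    then have "iv (?v i) = (\<Sum>j\<in>J. z j *s iv (?v j))"
      by (simp add: vec_eq_iff iv_def column_def sum_component mult.commute)
    also have "\<dots> \<in> module.span (*s) (iv ` B)"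
      unfolding B
      by (intro module.span_sum[OF module_int_vec] module.span_scale[OF module_int_vec]
          module.span_base[OF module_int_vec]) simp
    finally show ?thesis .
  qed
  then have "module.span (*s) (iv ` range ?v) \<subseteq> module.span (*s) (iv ` B)"
    by (intro module.span_minimal[OF module_int_vec] module.subspace_span[OF module_int_vec]) blast
  moreover have "module.span (*s) (iv ` B) \<subseteq> module.span (*s) (iv ` range ?v)"
    unfolding B by (intro module.span_mono[OF module_int_vec] image_mono) blast
  ultimately show "lattice_gen B = lattice_gen (range ?v)" unfolding lattice by blast
qed

end
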